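(* Let $Z=\operatorname{Spec}\mathbb{C}[x_1,\dots,x_k]/(P_1,\dots,P_r)\subset\mathbb{A}^k$ be an affine scheme over $\mathbb{C}$, and let $g:\mathbb{A}^k\to\mathbb{A}^k$ be a linear automorphism of finite order $m$ which preserves $Z$ (i.e. preserves the ideal $(P_1,\dots,P_r)$). Let the linear coordinates $x_1,\dots,x_k$ be chosen so that $g$ acts diagonally, $g(x_i)=\xi_m^{\alpha_i}x_i$ with $\xi_m=\exp(2\pi i/m)$ and $0\le\alpha_i\le m-1$. Let $A_\infty=\mathbb{C}[\mathcal{J}Z]$ be the coordinate ring of the jet scheme of $Z$, with its commutative vertex algebra structure and the vertex algebra automorphism $\tilde g$ induced by $g$, and let $A^g_\infty=\mathbb{C}[\mathcal{J}^gZ]$ be the coordinate ring of the scheme of $g$-twisted jets to $Z$. Then $A_\infty^g$ carries the structure of a $\tilde g$-twisted $A_\infty$-module, given by the linear map $$Y_g:A_\infty\to\operatorname{End}(A^g_\infty)[[z^{1/m},z^{-1/m}]]$$ determined by $$Y_g(x_{i,0},z^{1/m})=\sum_{n\in\frac{\alpha_i}{m}+\mathbb{Z},\ n\le 0}x_{i,n}\,z^{-n}\qquad(1\le i\le k)$$ and $$Y_g(x_{i_1,n_1}\cdots x_{i_s,n_s},z^{1/m})=\prod_{j=1}^s\frac{1}{(-n_j)!}\,\partial_z^{-n_j}\,Y_g(x_{i_j,0},z^{1/m})$$ for all $s\ge 0$, $1\le i_j\le k$ and integers $n_j\le 0$ (the empty product being the identity), where elements of $A^g_\infty$ act on $A^g_\infty$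 by multiplication.
   Context: **Action on functions.** An automorphism $g$ of $\mathbb{A}^k$ acts on functions by $g(f)=f\circ g^{-1}$. **Jet scheme.** $\mathcal{J}Z$ is the scheme with $\operatorname{Hom}(\operatorname{Spec}R,\mathcal{J}Z)=\operatorname{Hom}(\operatorname{Spec}R[[t]],Z)$ for every commutative $\mathbb{C}$-algebra $R$. Writing $x_i(t)=\sum_{n\in\mathbb{Z},\,n\le0}x_{i,n}t^{-n}$, its coordinate ring is $A_\infty=\mathbb{C}[x_{i,n}: 1\le i\le k,\ n\in\mathbb{Z}_{\le 0}]/I$, where $I$ is generated by all coefficients of all powers of $t$ in $P_j(x_1(t),\dots,x_k(t))$, $1\le j\le r$. **Twisted jets.** $\mathcal{J}^gZ$ is the scheme of $g$-equivariant jets, i.e. maps $x(t^{1/m})\in\operatorname{Hom}(\operatorname{Spec}\mathbb{C}[[t^{1/m}]],Z)$ with $x(\xi_m t^{1/m})=g(x(t^{1/m}))$ (and similarly with $\mathbb{C}$ replaced by any commutative $\mathbb{C}$-algebra $R$). Writing $x_i(t^{1/m})=\sum_{n\in\frac{\alpha_i}{m}+\mathbb{Z},\,n\le0}x_{i,n}t^{-n}$, its coordinate ring is $A^g_\infty=\mathbb{C}[x_{i,n}: 1\le i\le k,\ n\in\frac{\alpha_i}{m}+\mathbb{Z},\ n\le0]/I^g$, where $I^g$ is generated by all coefficients of all powers of $t^{1/m}$ in $P_j(x_1(t^{1/m}),\dots,x_k(t^{1/m}))$, $1\le j\le r$. **Vertex algebra structure on $A_\infty$.** $A_\infty$ has the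 derivation $T$ with $T x_{i,n}=-(n-1)x_{i,n-1}$. It is a commutative vertex algebra with vacuum vector $\mathbf 1=1$, translation operator $T$, and $Y(a,z)=\sum_{n\in\mathbb{Z}}a_{(n)}z^{-n-1}:=e^{zT}(a)=\sum_{n\ge0}\frac{z^n}{n!}T^n(a)$, acting by multiplication. The automorphism $\tilde g$ of $A_\infty$ is the algebra automorphism with $\tilde g(x_{i,n})=\xi_m^{\alpha_i}x_{i,n}$; it commutes with $T$, hence is a vertex algebra automorphism, i.e. $\tilde g(a)_{(n)}\tilde g(b)=\tilde g(a_{(n)}b)$. **Twisted modules.** Let $V$ be a vertex algebra and $\sigma$ an automorphism of $V$ with $\sigma^m=1$; for $0\le r\le m-1$ let $V^r=\{u\in V:\sigma u=\xi_m^r u\}$. A $\sigma$-twisted $V$-module is a vector space $M$ with a linear map $Y_M:V\to\operatorname{End}(M)[[z^{1/m},z^{-1/m}]]$, $Y_M(a,z^{1/m})=\sum_{n\in\frac1m\mathbb{Z}}a_{(n)}z^{-n-1}$, such that: 1. $Y_M(a,z^{1/m})=\sum_{n\in\frac rm+\mathbb{Z}}a_{(n)}z^{-n-1}$ for $a\in V^r$; 2. $Y_M(a,z^{1/m})v\in M((z^{1/m}))$ for $a\in V$, $v\in M$; 3. $Y_M(\mathbf 1,z^{1/m})=\mathrm{id}_M$; 4. for $a\in V^r$, $b\in V^s$, $p\in\frac rm+\mathbb{Z}$, $q\in\frac sm+\mathbb{Z}$, $l\in\mathbb{Z}$, $$\sum_{i\ge0}\binom pi(a_{(l+i)}b)_{(p+q-i)}=\sum_{i\ge0}\binom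 li(-1)^i\bigl(a_{(l+p-i)}b_{(q+i)}+(-1)^{l+1}b_{(l+q-i)}a_{(p+i)}\bigr).$$ *)

theory Defs
  imports
    Complex_Main
    "HOL-Library.Poly_Mapping"
    "HOL-Computational_Algebra.Formal_Power_Series"
    "HOL-Algebra.QuotRing"
    "Jordan_Normal_Form.VS_Connect"
begin

section \<open>Polynomials over the complex numbers in a set of variables\<close>

type_synonym 'v cpoly = "('v \<Rightarrow>\<^sub>0 nat) \<Rightarrow>\<^sub>0 complex"

definition const :: "complex \<Rightarrow> 'v cpoly" where
  "const c = Poly_Mapping.single 0 c"

definition var :: "'v \<Rightarrow> 'v cpoly" where
  "var v = Poly_Mapping.single (Poly_Mapping.single v 1) 1"

definition poly_ring :: "'v set \<Rightarrow> 'v cpoly ring" where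
  "poly_ring X = class_ring\<lparr>carrier := {p. \<forall>mon\<in>Poly_Mapping.keys p. Poly_Mapping.keys mon \<subseteq> X}\<rparr>"

text \<open>Evaluation at \<open>x\<close> in a commutative \<open>\<complex>\<close>-algebra whose structure map is \<open>h\<close>.\<close>

definition eval_poly ::
    "(complex \<Rightarrow> 'a) \<Rightarrow> ('v \<Rightarrow> 'a) \<Rightarrow> 'v cpoly \<Rightarrow> 'a::comm_ring_1" where
  "eval_poly h x p =
     (\<Sum>mon\<in>Poly_Mapping.keys p. h (Poly_Mapping.lookup p mon) *
        (\<Prod>v\<in>Poly_Mapping.keys mon. x v ^ Poly_Mapping.lookup mon v))"

text \<open>The derivation sending each variable \<open>v\<close> to \<open>d v\<close>, by the product rule on monomials.\<close>

definition derivation_poly :: "('v \<Rightarrow> 'v cpoly) \<Rightarrow> 'v cpoly \<Rightarrow> 'v cpoly" where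
  "derivation_poly d p =
     (\<Sum>mon\<in>Poly_Mapping.keys p. \<Sum>v\<in>Poly_Mapping.keys mon.
        Poly_Mapping.single (mon - Poly_Mapping.single v 1)
          (of_nat (Poly_Mapping.lookup mon v) * Poly_Mapping.lookup p mon) * d v)"

text \<open>The map of cosets induced by a map \<open>f\<close> of representatives; meaningful when \<open>f\<close>
  respects cosets, so that the image below is a singleton.\<close>

definition quot_map :: "('a, 'b) ring_scheme \<Rightarrow> 'a set \<Rightarrow> ('a \<Rightarrow> 'a) \<Rightarrow> 'a set \<Rightarrow> 'a set" where
  "quot_map R I f C = the_elem ((\<lambda>p. I +>\<^bsub>R\<^esub> f p) ` C)"


section \<open>The linear automorphism\<close>

definition unity_root :: "nat \<Rightarrow> complex" where
  "unity_root m = exp (2 * of_real pi * \<i> / of_nat m)"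

text \<open>The automorphism of affine \<open>k\<close>-space is given by its matrix \<open>g\<close>. The relation below says
  that the polynomial \<open>h\<close> is \<open>g(f) = f \<circ> g\<^sup>-\<^sup>1\<close>, i.e. \<open>h(g v) = f(v)\<close> at all points \<open>v\<close>; over \<open>\<complex>\<close>
  a polynomial is determined by its values.\<close>

definition acts_to :: "nat \<Rightarrow> complex mat \<Rightarrow> nat cpoly \<Rightarrow> nat cpoly \<Rightarrow> bool" where
  "acts_to k g f h \<longleftrightarrow>
     f \<in> carrier (poly_ring {..<k}) \<and> h \<in> carrier (poly_ring {..<k}) \<and>
     (\<forall>v\<in>carrier_vec k. eval_poly id (vec_index (g *\<^sub>v v)) h = eval_poly id (vec_index v) f)"

definition has_order :: "nat \<Rightarrow> complex mat \<Rightarrow> nat \<Rightarrow> bool" where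
  "has_order k g m \<longleftrightarrow> 0 < m \<and> g ^\<^sub>m m = 1\<^sub>m k \<and> (\<forall>d. 0 < d \<and> d < m \<longrightarrow> g ^\<^sub>m d \<noteq> 1\<^sub>m k)"


section \<open>Coordinate rings of jet schemes\<close>

text \<open>The variable \<open>x\<^sub>i\<^sub>,\<^sub>n\<close> is the pair \<open>(i, n)\<close>, with coordinates numbered from \<open>0\<close> to \<open>k - 1\<close>.
  Everything is stated for \<open>g\<close>-twisted jets; ordinary jets are the case \<open>m = 1\<close>, \<open>\<alpha> = 0\<close>
  (that is, \<open>g = id\<close>), where \<open>n\<close> ranges over the non-positive integers.\<close>

definition jet_vars :: "nat \<Rightarrow> nat \<Rightarrow> (nat \<Rightarrow> nat) \<Rightarrow> (nat \<times> rat) set" where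
  "jet_vars k m \<alpha> = {(i, n). i < k \<and> n - of_nat (\<alpha> i) / of_nat m \<in> \<int> \<and> n \<le> 0}"

text \<open>\<open>x\<^sub>i(t\<^sup>1\<^sup>/\<^sup>m)\<close> as a power series in \<open>t\<^sup>1\<^sup>/\<^sup>m\<close>: the coefficient of \<open>t\<^sup>e\<^sup>/\<^sup>m\<close> is \<open>x\<^sub>i\<^sub>,\<^sub>-\<^sub>e\<^sub>/\<^sub>m\<close>.\<close>

definition jet_series :: "nat \<Rightarrow> nat \<Rightarrow> (nat \<Rightarrow> nat) \<Rightarrow> nat \<Rightarrow> (nat \<times> rat) cpoly fps" where
  "jet_series k m \<alpha> i = Abs_fps (\<lambda>e. let n = - (of_nat e / of_nat m) in
     if (i, n) \<in> jet_vars k m \<alpha> then var (i, n) else 0)"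

abbreviation jet_poly_ring :: "nat \<Rightarrow> nat \<Rightarrow> (nat \<Rightarrow> nat) \<Rightarrow> (nat \<times> rat) cpoly ring" where
  "jet_poly_ring k m \<alpha> \<equiv> poly_ring (jet_vars k m \<alpha>)"

definition jet_ideal ::
    "nat \<Rightarrow> nat \<Rightarrow> (nat \<Rightarrow> nat) \<Rightarrow> nat cpoly list \<Rightarrow> (nat \<times> rat) cpoly set" where
  "jet_ideal k m \<alpha> Ps =
     Idl\<^bsub>jet_poly_ring k m \<alpha>\<^esub>
       {fps_nth (eval_poly (\<lambda>c. fps_const (const c)) (jet_series k m \<alpha>) P) e | P e. P \<in> set Ps}"

definition jet_class ::
    "nat \<Rightarrow> nat \<Rightarrow> (nat \<Rightarrow> nat) \<Rightarrow> nat cpoly list \<Rightarrow> (nat \<times> rat) cpoly \<Rightarrow> (nat \<times> rat) cpoly set"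
  where "jet_class k m \<alpha> Ps p = jet_ideal k m \<alpha> Ps +>\<^bsub>jet_poly_ring k m \<alpha>\<^esub> p"

definition jet_algebra ::
    "nat \<Rightarrow> nat \<Rightarrow> (nat \<Rightarrow> nat) \<Rightarrow> nat cpoly list \<Rightarrow> (complex, (nat \<times> rat) cpoly set) module" where
  "jet_algebra k m \<alpha> Ps =
     (let Q = jet_poly_ring k m \<alpha> Quot jet_ideal k m \<alpha> Ps in
      \<lparr>carrier = carrier Q, mult = mult Q, one = one Q, zero = zero Q, add = add Q,
       smult = (\<lambda>c a. jet_class k m \<alpha> Ps (const c) \<otimes>\<^bsub>Q\<^esub> a)\<rparr>)"


section \<open>Formal series of operators\<close>

text \<open>A formal series \<open>\<Sum>\<^sub>e F\<^sub>e z\<^sup>e\<close> with coefficients in \<open>End(M)\<close> is the function \<open>e \<mapsto> F\<^sub>e\<close> on rational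
  exponents. The coefficients are only relevant on the carrier of \<open>M\<close>.\<close>

type_synonym 'a op_series = "rat \<Rightarrow> 'a \<Rightarrow> 'a"

text \<open>Linear maps from \<open>V\<close> to the space of series \<open>End(M)[[z\<^sup>1\<^sup>/\<^sup>m, z\<^sup>-\<^sup>1\<^sup>/\<^sup>m]]\<close>.\<close>

definition series_map ::
    "nat \<Rightarrow> (complex, 'v) module \<Rightarrow> (complex, 'w) module \<Rightarrow> ('v \<Rightarrow> 'w op_series) \<Rightarrow> bool" where
  "series_map m V M Y \<longleftrightarrow>
     (\<forall>a\<in>carrier V. \<forall>e. Y a e \<in> module_hom class_ring M M) \<and>
     (\<forall>e. \<forall>v\<in>carrier M. (\<lambda>a. Y a e v) \<in> module_hom class_ring V M) \<and>
     (\<forall>a\<in>carrier V. \<forall>e. of_nat m * e \<notin> \<int> \<longrightarrow> (\<forall>v\<in>carrier M. Y a e v = \<zero>\<^bsub>M\<^esub>))"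

text \<open>The coefficient \<open>a\<^sub>(\<^sub>n\<^sub>)\<close> of \<open>z\<^sup>-\<^sup>n\<^sup>-\<^sup>1\<close>.\<close>

definition mode :: "'a op_series \<Rightarrow> rat \<Rightarrow> 'a \<Rightarrow> 'a" where
  "mode F n = F (- n - 1)"

text \<open>Sum of a family with finitely many nonzero terms.\<close>

definition fsum :: "(complex, 'a) module \<Rightarrow> ('i \<Rightarrow> 'a) \<Rightarrow> 'a" where
  "fsum M f = (\<Oplus>\<^bsub>M\<^esub>i\<in>{i. f i \<noteq> \<zero>\<^bsub>M\<^esub>}. f i)"

definition series_deriv :: "(complex, 'a) module \<Rightarrow> 'a op_series \<Rightarrow> 'a op_series" where
  "series_deriv M F = (\<lambda>e v. of_rat (e + 1) \<odot>\<^bsub>M\<^esub> F (e + 1) v)"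

definition series_scale :: "(complex, 'a) module \<Rightarrow> complex \<Rightarrow> 'a op_series \<Rightarrow> 'a op_series" where
  "series_scale M c F = (\<lambda>e v. c \<odot>\<^bsub>M\<^esub> F e v)"

definition series_one :: "(complex, 'a) module \<Rightarrow> 'a op_series" where
  "series_one M = (\<lambda>e v. if e = 0 then v else \<zero>\<^bsub>M\<^esub>)"

text \<open>Cauchy product, with composition of operators; defined for series whose product has, on each
  vector, finitely many contributions to each coefficient, e.g. for series in \<open>End(M)((z\<^sup>1\<^sup>/\<^sup>m))\<close>.\<close>

definition series_mult ::
    "(complex, 'a) module \<Rightarrow> 'a op_series \<Rightarrow> 'a op_series \<Rightarrow> 'a op_series" where
  "series_mult M F G = (\<lambda>e v. fsum M (\<lambda>a. F a (G (e - a) v)))"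

definition series_prod_list :: "(complex, 'a) module \<Rightarrow> 'a op_series list \<Rightarrow> 'a op_series" where
  "series_prod_list M Fs = foldr (series_mult M) Fs (series_one M)"


section \<open>Vertex algebras and twisted modules\<close>

text \<open>The identity is one of operators on \<open>M\<close>. Both sums are finite on each vector, by the
  truncation axioms for \<open>V\<close> and \<open>M\<close>. The Borcherds identity of a vertex algebra is the case
  \<open>M = V\<close> with integers \<open>p\<close> and \<open>q\<close>.\<close>

definition borcherds_identity ::
    "('v \<Rightarrow> 'v op_series) \<Rightarrow> (complex, 'w) module \<Rightarrow> ('v \<Rightarrow> 'w op_series)
      \<Rightarrow> 'v \<Rightarrow> 'v \<Rightarrow> rat \<Rightarrow> rat \<Rightarrow> int \<Rightarrow> bool" where
  "borcherds_identity Y M YM a b p q l \<longleftrightarrow>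
     (\<forall>v\<in>carrier M.
        fsum M (\<lambda>i::nat. of_rat (p gchoose i) \<odot>\<^bsub>M\<^esub>
          mode (YM (mode (Y a) (of_int l + of_nat i) b)) (p + q - of_nat i) v)
      = fsum M (\<lambda>i::nat. ((of_int l gchoose i) * (-1) ^ i) \<odot>\<^bsub>M\<^esub>
          (mode (YM a) (of_int l + p - of_nat i) (mode (YM b) (q + of_nat i) v) \<oplus>\<^bsub>M\<^esub>
           ((-1) powi (l + 1)) \<odot>\<^bsub>M\<^esub>
             mode (YM b) (of_int l + q - of_nat i) (mode (YM a) (p + of_nat i) v))))"

locale vertex_algebra =
  V?: vectorspace "class_ring :: complex ring" V
  for V :: "(complex, 'v) module" +
  fixes vac :: 'v and T :: "'v \<Rightarrow> 'v" and Y :: "'v \<Rightarrow> 'v op_series"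
  assumes Y_series: "series_map 1 V V Y"
    and vac_closed: "vac \<in> carrier V"
    and T_hom: "T \<in> module_hom class_ring V V"
    and Y_truncation: "\<lbrakk>a \<in> carrier V; b \<in> carrier V\<rbrakk> \<Longrightarrow> \<exists>N. \<forall>e<N. Y a e b = \<zero>\<^bsub>V\<^esub>"
    and Y_vacuum: "b \<in> carrier V \<Longrightarrow> Y vac e b = (if e = 0 then b else \<zero>\<^bsub>V\<^esub>)"
    and Y_creation: "a \<in> carrier V \<Longrightarrow> e < 0 \<Longrightarrow> Y a e vac = \<zero>\<^bsub>V\<^esub>"
      "a \<in> carrier V \<Longrightarrow> Y a 0 vac = a"
    and T_vacuum: "T vac = \<zero>\<^bsub>V\<^esub>"
    and T_covariance: "\<lbrakk>a \<in> carrier V; b \<in> carrier V\<rbrakk> \<Longrightarrow>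
      T (Y a e b) \<ominus>\<^bsub>V\<^esub> Y a e (T b) = series_deriv V (Y a) e b"
    and Y_borcherds: "\<lbrakk>a \<in> carrier V; b \<in> carrier V; p \<in> \<int>; q \<in> \<int>\<rbrakk> \<Longrightarrow>
      borcherds_identity Y V Y a b p q l"

locale vertex_algebra_automorphism = vertex_algebra V vac T Y
  for V :: "(complex, 'v) module" and vac T Y +
  fixes \<sigma> :: "'v \<Rightarrow> 'v"
  assumes aut_hom: "\<sigma> \<in> module_hom class_ring V V"
    and aut_bij: "bij_betw \<sigma> (carrier V) (carrier V)"
    and aut_vac: "\<sigma> vac = vac"
    and aut_modes: "\<lbrakk>a \<in> carrier V; b \<in> carrier V; n \<in> \<int>\<rbrakk> \<Longrightarrow>
      mode (Y (\<sigma> a)) n (\<sigma> b) = \<sigma> (mode (Y a) n b)"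

definition eigenspace :: "(complex, 'v) module \<Rightarrow> nat \<Rightarrow> ('v \<Rightarrow> 'v) \<Rightarrow> nat \<Rightarrow> 'v set" where
  "eigenspace V m \<sigma> s = {u \<in> carrier V. \<sigma> u = (unity_root m ^ s) \<odot>\<^bsub>V\<^esub> u}"

locale twisted_module =
  vertex_algebra_automorphism V vac T Y \<sigma> +
  M: vectorspace "class_ring :: complex ring" M
  for V :: "(complex, 'v) module" and vac T Y and \<sigma> :: "'v \<Rightarrow> 'v"
    and M :: "(complex, 'w) module" +
  fixes m :: nat and YM :: "'v \<Rightarrow> 'w op_series"
  assumes m_pos: "0 < m"
    and aut_power: "a \<in> carrier V \<Longrightarrow> (\<sigma> ^^ m) a = a"
    and YM_series: "series_map m V M YM"
    and YM_grading: "\<lbrakk>s < m; a \<in> eigenspace V m \<sigma> s; v \<in> carrier M;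
      n - of_nat s / of_nat m \<notin> \<int>\<rbrakk> \<Longrightarrow> mode (YM a) n v = \<zero>\<^bsub>M\<^esub>"
    and YM_truncation: "\<lbrakk>a \<in> carrier V; v \<in> carrier M\<rbrakk> \<Longrightarrow> \<exists>N. \<forall>e<N. YM a e v = \<zero>\<^bsub>M\<^esub>"
    and YM_vacuum: "v \<in> carrier M \<Longrightarrow> YM vac e v = (if e = 0 then v else \<zero>\<^bsub>M\<^esub>)"
    and YM_borcherds: "\<lbrakk>s < m; s' < m; a \<in> eigenspace V m \<sigma> s; b \<in> eigenspace V m \<sigma> s';
      p - of_nat s / of_nat m \<in> \<int>; q - of_nat s' / of_nat m \<in> \<int>\<rbrakk> \<Longrightarrow>
      borcherds_identity Y M YM a b p q l"


section \<open>The vertex algebra of jets and its automorphism\<close>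

abbreviation jet_VA :: "nat \<Rightarrow> nat cpoly list \<Rightarrow> (complex, (nat \<times> rat) cpoly set) module" where
  "jet_VA k Ps \<equiv> jet_algebra k 1 (\<lambda>_. 0) Ps"

definition jet_T ::
    "nat \<Rightarrow> nat cpoly list \<Rightarrow> (nat \<times> rat) cpoly set \<Rightarrow> (nat \<times> rat) cpoly set" where
  "jet_T k Ps =
     quot_map (jet_poly_ring k 1 (\<lambda>_. 0)) (jet_ideal k 1 (\<lambda>_. 0) Ps)
       (derivation_poly (\<lambda>(i, n). const (of_rat (- (n - 1))) * var (i, n - 1)))"

text \<open>\<open>Y(a,z) = \<Sum>\<^sub>n z\<^sup>n T\<^sup>n(a) / n!\<close>, acting by multiplication.\<close>

definition jet_Y ::
    "nat \<Rightarrow> nat cpoly list \<Rightarrow> (nat \<times> rat) cpoly set \<Rightarrow> (nat \<times> rat) cpoly set op_series" where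
  "jet_Y k Ps a e b =
     (if e \<in> \<nat>
      then let n = nat \<lfloor>e\<rfloor> in
        ((1 / fact n) \<odot>\<^bsub>jet_VA k Ps\<^esub> (jet_T k Ps ^^ n) a) \<otimes>\<^bsub>jet_VA k Ps\<^esub> b
      else \<zero>\<^bsub>jet_VA k Ps\<^esub>)"

definition jet_aut ::
    "nat \<Rightarrow> nat \<Rightarrow> (nat \<Rightarrow> nat) \<Rightarrow> nat cpoly list \<Rightarrow> (nat \<times> rat) cpoly set \<Rightarrow> (nat \<times> rat) cpoly set"
  where
  "jet_aut k m \<alpha> Ps =
     quot_map (jet_poly_ring k 1 (\<lambda>_. 0)) (jet_ideal k 1 (\<lambda>_. 0) Ps)
       (eval_poly const (\<lambda>(i, n). const (unity_root m ^ \<alpha> i) * var (i, n)))"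

definition jet_monomial ::
    "nat \<Rightarrow> nat cpoly list \<Rightarrow> (nat \<times> int) list \<Rightarrow> (nat \<times> rat) cpoly set" where
  "jet_monomial k Ps xs =
     jet_class k 1 (\<lambda>_. 0) Ps (prod_list (map (\<lambda>(i, n). var (i, of_int n)) xs))"

end

theory Submission
  imports Defs
    "HOL-Computational_Algebra.Formal_Laurent_Series"
    "HOL-Library.Real_Mod"
begin

text \<open>
  The coordinate ring of twisted jets contains the universal twisted jet \<open>x\<^sub>i(z\<^sup>1\<^sup>/\<^sup>m)\<close>, a solution of the
  equations \<open>P\<^sub>j = 0\<close> in formal Puiseux series. Since the ordinary jet algebra is the universal differential
  algebra with a solution of the same equations, with \<open>x\<^sub>i\<^sub>,\<^sub>n\<close> standing for the divided derivative
  \<open>T\<^sup>-\<^sup>n x\<^sub>i\<^sub>,\<^sub>0 / (-n)!\<close>, this solution defines a homomorphism of differential algebras from ordinary jets to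
  Puiseux series over twisted jets, with \<open>T\<close> going to \<open>d/dz\<close>. The map \<open>Y\<^sub>g\<close> is this homomorphism, its
  coefficients acting by multiplication. Everything else is a consequence.

  All computations are done with polynomials and only the results are passed to the quotients. A Puiseux
  series is a Laurent series in \<open>u = z\<^sup>1\<^sup>/\<^sup>m\<close>, on which \<open>d/dz\<close> is the derivation \<open>zdiff\<close>. The homomorphism is
  \<open>jet_hom\<close>; it intertwines the derivations by \<open>jet_hom_deriv\<close>. For \<open>m = 1\<close> and trivial weights it is
  \<open>p \<mapsto> \<Sum>\<^sub>j T\<^sup>j p u\<^sup>j / j!\<close> (\<open>jet_hom_untwisted_coeff\<close>), so the vertex operators of the jet algebra are an instance
  of the same construction, and the generators of the jet ideal are the polynomials \<open>T\<^sup>j P(x\<^sub>.\<^sub>,\<^sub>0) / j!\<close>. The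
  homomorphism sends such a generator to the \<open>j\<close>-th divided derivative of \<open>P(x(z\<^sup>1\<^sup>/\<^sup>m))\<close>, whose coefficients
  lie in the ideal of twisted jets. This is \<open>jet_hom_ideal\<close>, and it makes \<open>Y\<^sub>g\<close> well defined.

  The grading axiom is equivariance: substituting \<open>\<xi>\<^sub>m\<^sup>-\<^sup>1 u\<close> for \<open>u\<close> in the image of \<open>p\<close> gives the
  image of \<open>g(p)\<close> (\<open>jet_hom_rot\<close>). The Borcherds identity for commuting series (\<open>borcherds_coeffs\<close>) compares
  finite sums of products of coefficients. For \<open>l \<ge> 0\<close> the left side is zero and the right side cancels in pairs;
  for \<open>l = -L - 1\<close> both sides are the sum of \<open>C(j, L) F\<^sub>j\<^sub>-\<^sub>p G\<^sub>e\<^sub>-\<^sub>j\<^sub>+\<^sub>p\<close> over all integers \<open>j\<close>, where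
  \<open>e = L - p - q - 1\<close>; for the left side this is Vandermonde's identity. The argument needs the exponents
  of \<open>F\<close> to lie in \<open>-p + \<int>\<close>, which is what the grading provides once an eigenvector is represented by an eigenvector among the polynomials (\<open>eigenspace_representative\<close>).

  Uniqueness holds because the monomials span the jet algebra and the two conditions on \<open>Y\<^sub>g\<close>
  prescribe its values on them (\<open>represents_unique\<close>).
\<close>

section \<open>Polynomials in a set of variables\<close>

lemma const_hom: "const 0 = 0" "const 1 = 1" "const (a + b) = const a + const b"
    "const (a * b) = const a * const b" "const (- a) = - const a" "const (a - b) = const a - const b"
  by (simp_all add: const_def single_add single_uminus single_diff mult_single)

lemma const_sum: "const (sum f S) = (\<Sum>i\<in>S. const (f i))"
  by (induction S rule: infinite_finite_induct) (simp_all add: const_hom)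

lemma const_of_int: "const (of_int n) = of_int n"
  by (simp add: const_def)

lemma const_of_nat: "const (of_nat n) = of_nat n"
  by (simp add: const_def)

definition polys :: "'v set \<Rightarrow> 'v cpoly set" where
  "polys X = {p. \<forall>mo\<in>Poly_Mapping.keys p. Poly_Mapping.keys mo \<subseteq> X}"

lemma poly_ring_simps [simp]: "mult (poly_ring X) = (*)" "one (poly_ring X) = 1"
    "add (poly_ring X) = (+)" "zero (poly_ring X) = 0" "carrier (poly_ring X) = polys X"
  by (simp_all add: poly_ring_def polys_def)

lemma polys_add: "p \<in> polys X \<Longrightarrow> q \<in> polys X \<Longrightarrow> p + q \<in> polys X"
  using keys_add[of p q] by (auto simp: polys_def)

lemma polys_mult: "p \<in> polys X \<Longrightarrow> q \<in> polys X \<Longrightarrow> p * q \<in> polys X"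
proof (clarsimp simp: polys_def, goal_cases)
  case (1 mo x)
  then obtain a b where "mo = a + b" "a \<in> Poly_Mapping.keys p" "b \<in> Poly_Mapping.keys q"
    using keys_mult[of p q] by blast
  then show ?case using 1 keys_add[of a b] by blast
qed

lemma polys_uminus: "p \<in> polys X \<Longrightarrow> - p \<in> polys X"
  by (auto simp: polys_def in_keys_iff)

lemma polys_const [simp]: "const c \<in> polys X"
  by (simp add: polys_def const_def)

lemma polys_0 [simp]: "0 \<in> polys X" and polys_1 [simp]: "1 \<in> polys X"
  by (auto simp: polys_def)

lemma polys_var: "v \<in> X \<Longrightarrow> var v \<in> polys X"
  by (simp add: polys_def var_def)

lemma polys_sum: "(\<And>i. i \<in> S \<Longrightarrow> f i \<in> polys X) \<Longrightarrow> sum f S \<in> polys X"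
  by (induction S rule: infinite_finite_induct) (simp_all add: polys_add)

text \<open>A monomial is a product of variables, so closure under sums and products reduces every
  statement about polynomials to constants and variables.\<close>

lemma polys_induct [consumes 1, case_names const var add mult]:
  assumes p: "p \<in> polys X"
    and const: "\<And>c. Q (const c)" and var: "\<And>v. v \<in> X \<Longrightarrow> Q (var v)"
    and add: "\<And>p q. p \<in> polys X \<Longrightarrow> q \<in> polys X \<Longrightarrow> Q p \<Longrightarrow> Q q \<Longrightarrow> Q (p + q)"
    and mult: "\<And>p q. p \<in> polys X \<Longrightarrow> q \<in> polys X \<Longrightarrow> Q p \<Longrightarrow> Q q \<Longrightarrow> Q (p * q)"
  shows "Q p"
proof -
  have monom: "Poly_Mapping.single mo 1 \<in> polys X \<and> Q (Poly_Mapping.single mo (1::complex))"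
    if "Poly_Mapping.keys mo \<subseteq> X" for mo :: "'a \<Rightarrow>\<^sub>0 nat"
    using that
  proof (induction "sum (Poly_Mapping.lookup mo) (Poly_Mapping.keys mo)" arbitrary: mo)
    case 0
    then have "mo = 0" by (intro poly_mapping_eqI) (auto simp: in_keys_iff)
    then show ?case using const[of 1] by (simp add: const_def)
  next
    case (Suc n)
    then obtain v where v: "v \<in> Poly_Mapping.keys mo" by (metis ex_in_conv sum.empty nat.distinct(1))
    define mo' where "mo' = mo - Poly_Mapping.single v 1"
    have mo: "mo = mo' + Poly_Mapping.single v 1"
      using v unfolding mo'_def
      by (intro poly_mapping_eqI) (auto simp: lookup_add lookup_minus lookup_single when_def in_keys_iff)
    have sub: "Poly_Mapping.keys mo' \<subseteq> Poly_Mapping.keys mo"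
      unfolding mo by (auto simp: in_keys_iff lookup_add)
    have "sum (Poly_Mapping.lookup mo') (Poly_Mapping.keys mo')
        = sum (Poly_Mapping.lookup mo') (Poly_Mapping.keys mo)"
      by (rule sum.mono_neutral_left) (use sub in \<open>auto simp: in_keys_iff\<close>)
    moreover have "sum (Poly_Mapping.lookup mo) (Poly_Mapping.keys mo)
        = sum (Poly_Mapping.lookup mo') (Poly_Mapping.keys mo) + 1"
      using v by (subst (1) mo) (simp add: lookup_add sum.distrib lookup_single when_def)
    ultimately have "n = sum (Poly_Mapping.lookup mo') (Poly_Mapping.keys mo')"
      using Suc(2) by simp
    then have IH: "Poly_Mapping.single mo' 1 \<in> polys X \<and> Q (Poly_Mapping.single mo' 1)"
      using Suc(1)[of mo'] sub Suc(3) by blast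
    have "Poly_Mapping.single mo (1::complex) = Poly_Mapping.single mo' 1 * var v"
      unfolding mo var_def by (simp add: mult_single)
    then show ?case using IH mult[of "Poly_Mapping.single mo' 1" "var v"] var[of v]
        polys_var[of v X] polys_mult[of "Poly_Mapping.single mo' 1" X "var v"] v Suc(3) by auto
  qed
  have "p \<in> polys X \<and> Q p" using p
  proof (induction "card (Poly_Mapping.keys p)" arbitrary: p)
    case 0
    then show ?case using const[of 0] by (simp add: const_hom)
  next
    case (Suc n)
    then obtain mo where m: "mo \<in> Poly_Mapping.keys p" by fastforce
    define c where "c = Poly_Mapping.lookup p mo"
    define p' where "p' = p - Poly_Mapping.single mo c"
    have keys: "Poly_Mapping.keys p' = Poly_Mapping.keys p - {mo}"
      unfolding p'_def c_def
      by (auto simp: in_keys_iff lookup_minus lookup_single when_def split: if_splits)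
    have "p' \<in> polys X \<and> Q p'"
      using Suc(2,3) m unfolding keys by (intro Suc(1)) (auto simp: polys_def keys)
    moreover have p: "p = p' + const c * Poly_Mapping.single mo 1"
      by (simp add: p'_def const_def mult_single)
    moreover have "const c * Poly_Mapping.single mo 1 \<in> polys X
        \<and> Q (const c * Poly_Mapping.single mo 1)"
      using monom[of mo] m Suc(3) mult[OF polys_const _ const, of "Poly_Mapping.single mo 1" c]
        polys_mult[OF polys_const, of "Poly_Mapping.single mo 1"] by (auto simp: polys_def)
    ultimately show ?case using add[of p' "const c * Poly_Mapping.single mo 1"] Suc(3) by metis
  qed
  then show ?thesis ..
qed

text \<open>The monomials span. Multiplying by an arbitrary polynomial \<open>r\<close> whose multiples by
  monomials have the property makes the statement stable under products, so that the previous induction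
  applies.\<close>

lemma polys_monomial_induct [consumes 1, case_names monomial scale add]:
  assumes p: "p \<in> polys X"
    and monomial: "\<And>vs. set vs \<subseteq> X \<Longrightarrow> S (prod_list (map var vs))"
    and scale: "\<And>c p. p \<in> polys X \<Longrightarrow> S p \<Longrightarrow> S (const c * p)"
    and add: "\<And>p q. p \<in> polys X \<Longrightarrow> q \<in> polys X \<Longrightarrow> S p \<Longrightarrow> S q \<Longrightarrow> S (p + q)"
  shows "S p"
proof -
  let ?mon = "\<lambda>vs. prod_list (map var vs)"
  have mon_closed: "?mon vs \<in> polys X" if "set vs \<subseteq> X" for vs
    using that by (induction vs) (simp_all add: polys_mult polys_var)
  have "\<forall>r\<in>polys X. (\<forall>vs. set vs \<subseteq> X \<longrightarrow> S (r * ?mon vs)) \<longrightarrow> (\<forall>vs. set vs \<subseteq> X \<longrightarrow> S (p * r * ?mon vs))"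
    using p
  proof (induction p rule: polys_induct)
    case (const c)
    then show ?case using scale[of "_ * _" c] by (auto simp: mult.assoc polys_mult mon_closed)
  next
    case (var v)
    show ?case
    proof (intro ballI allI impI)
      fix r vs assume r: "\<forall>vs. set vs \<subseteq> X \<longrightarrow> S (r * ?mon vs)" and vs: "set vs \<subseteq> X"
      have "set (v # vs) \<subseteq> X" using vs var by simp
      then have "S (r * ?mon (v # vs))" using r by blast
      then show "S (var v * r * ?mon vs)" by (simp add: mult_ac)
    qed
  next
    case (add p q)
    then show ?case using assms(4)[of "p * _ * _" "q * _ * _"]
      by (auto simp: distrib_right polys_mult mon_closed)
  next
    case (mult p q)
    show ?case
    proof (intro ballI impI)
      fix r assume r: "r \<in> polys X" and "\<forall>vs. set vs \<subseteq> X \<longrightarrow> S (r * ?mon vs)"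
      then have "\<forall>vs. set vs \<subseteq> X \<longrightarrow> S (q * r * ?mon vs)" using mult.IH(2) by blast
      then have "\<forall>vs. set vs \<subseteq> X \<longrightarrow> S (p * (q * r) * ?mon vs)"
        using mult.IH(1) polys_mult[OF mult.hyps(2) r] by blast
      then show "\<forall>vs. set vs \<subseteq> X \<longrightarrow> S (p * q * r * ?mon vs)" by (simp add: mult.assoc)
    qed
  qed
  then have "\<forall>vs. set vs \<subseteq> X \<longrightarrow> S (p * 1 * ?mon vs)"
    using monomial by (metis mult_1_left polys_1)
  from this[rule_format, of "[]"] show ?thesis by simp
qed

lemma monomial_prod_add:
  fixes x :: "'v \<Rightarrow> 'a::comm_monoid_mult"
  shows "(\<Prod>v\<in>Poly_Mapping.keys (a + b). x v ^ Poly_Mapping.lookup (a + b) v) =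
    (\<Prod>v\<in>Poly_Mapping.keys a. x v ^ Poly_Mapping.lookup a v) *
    (\<Prod>v\<in>Poly_Mapping.keys b. x v ^ Poly_Mapping.lookup b v)"
proof -
  let ?S = "Poly_Mapping.keys a \<union> Poly_Mapping.keys b"
  have sup: "(\<Prod>v\<in>Poly_Mapping.keys c. x v ^ Poly_Mapping.lookup c v) =
      (\<Prod>v\<in>?S. x v ^ Poly_Mapping.lookup c v)" if "Poly_Mapping.keys c \<subseteq> ?S" for c :: "'v \<Rightarrow>\<^sub>0 nat"
    by (rule prod.mono_neutral_left) (use that in \<open>auto simp: in_keys_iff\<close>)
  show ?thesis
    unfolding sup[OF keys_add] sup[of a, OF Un_upper1] sup[of b, OF Un_upper2]
    by (simp add: lookup_add power_add prod.distrib)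
qed

lemma poly_sum_singles: "p = (\<Sum>mo\<in>Poly_Mapping.keys p. Poly_Mapping.single mo (Poly_Mapping.lookup p mo))"
  by (rule poly_mapping_eqI) (auto simp: lookup_sum lookup_single when_def in_keys_iff)

text \<open>The properties of a structure map under which evaluation at a point is a homomorphism of
  \<open>\<complex>\<close>-algebras.\<close>

locale coeff_hom =
  fixes h :: "complex \<Rightarrow> 'a::comm_ring_1"
  assumes h0: "h 0 = 0" and h1: "h 1 = 1"
    and hadd: "h (a + b) = h a + h b" and hmult: "h (a * b) = h a * h b"
begin

lemma eval_poly_superset:
  assumes "finite S" "Poly_Mapping.keys p \<subseteq> S"
  shows "eval_poly h x p = (\<Sum>mo\<in>S. h (Poly_Mapping.lookup p mo) *
        (\<Prod>v\<in>Poly_Mapping.keys mo. x v ^ Poly_Mapping.lookup mo v))"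
  unfolding eval_poly_def
  by (rule sum.mono_neutral_left) (use assms in \<open>auto simp: in_keys_iff h0\<close>)

lemma eval_poly_add: "eval_poly h x (p + q) = eval_poly h x p + eval_poly h x q"
proof -
  let ?S = "Poly_Mapping.keys p \<union> Poly_Mapping.keys q"
  show ?thesis
    using keys_add[of p q]
    by (simp add: eval_poly_superset[of ?S] lookup_add hadd distrib_right sum.distrib)
qed

lemma eval_poly_sum: "eval_poly h x (sum f S) = (\<Sum>i\<in>S. eval_poly h x (f i))"
proof -
  have [simp]: "eval_poly h x 0 = 0" by (simp add: eval_poly_def)
  show ?thesis by (induction S rule: infinite_finite_induct) (simp_all add: eval_poly_add)
qed

lemma eval_poly_single: "eval_poly h x (Poly_Mapping.single mo c) =
    h c * (\<Prod>v\<in>Poly_Mapping.keys mo. x v ^ Poly_Mapping.lookup mo v)"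
  by (simp add: eval_poly_def h0)

lemma eval_poly_const: "eval_poly h x (const c) = h c"
  by (simp add: const_def eval_poly_single)

lemma eval_poly_var: "eval_poly h x (var v) = x v"
  by (simp add: var_def eval_poly_single h1)

lemma eval_poly_mult: "eval_poly h x (p * q) = eval_poly h x p * eval_poly h x q"
proof -
  let ?s = "\<lambda>p mo. Poly_Mapping.single mo (Poly_Mapping.lookup p mo)"
  have "p * q = (\<Sum>a\<in>Poly_Mapping.keys p. \<Sum>b\<in>Poly_Mapping.keys q. ?s p a * ?s q b)"
    by (subst (1) poly_sum_singles[of p], subst (1) poly_sum_singles[of q]) (simp add: sum_product)
  then have "eval_poly h x (p * q) = (\<Sum>a\<in>Poly_Mapping.keys p. \<Sum>b\<in>Poly_Mapping.keys q.
      eval_poly h x (?s p a) * eval_poly h x (?s q b))"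
    by (simp add: eval_poly_sum mult_single eval_poly_single monomial_prod_add hmult mult_ac)
  also have "\<dots> = (\<Sum>a\<in>Poly_Mapping.keys p. eval_poly h x (?s p a)) *
      (\<Sum>b\<in>Poly_Mapping.keys q. eval_poly h x (?s q b))"
    by (simp add: sum_product)
  also have "\<dots> = eval_poly h x p * eval_poly h x q"
    by (metis eval_poly_sum poly_sum_singles)
  finally show ?thesis .
qed

lemma eval_poly_0: "eval_poly h x 0 = 0" and eval_poly_1: "eval_poly h x 1 = 1"
  using eval_poly_const[of x 0] eval_poly_const[of x 1] by (simp_all add: const_hom h0 h1)

end

interpretation id_hom: coeff_hom "\<lambda>a. a" by unfold_locales simp_all
interpretation const_hom: coeff_hom const by unfold_locales (simp_all add: const_hom)
interpretation fps_hom: coeff_hom "\<lambda>c. fps_const (const c)"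
  by unfold_locales (simp_all add: const_hom)
interpretation fls_hom: coeff_hom "\<lambda>c. fls_const (const c)"
  by unfold_locales (simp_all add: const_hom fls_plus_const)

lemma derivation_poly_add: "derivation_poly d (p + q) = derivation_poly d p + derivation_poly d q"
proof -
  let ?S = "Poly_Mapping.keys p \<union> Poly_Mapping.keys q"
  have sup: "derivation_poly d r = (\<Sum>mo\<in>?S. \<Sum>v\<in>Poly_Mapping.keys mo.
        Poly_Mapping.single (mo - Poly_Mapping.single v 1)
          (of_nat (Poly_Mapping.lookup mo v) * Poly_Mapping.lookup r mo) * d v)"
    if "Poly_Mapping.keys r \<subseteq> ?S" for r
    unfolding derivation_poly_def
    by (rule sum.mono_neutral_left) (use that in \<open>auto simp: in_keys_iff\<close>)
  show ?thesis
    by (simp add: sup keys_add lookup_add ring_distribs single_add sum.distrib)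
qed

lemma derivation_poly_0: "derivation_poly d 0 = 0"
  by (simp add: derivation_poly_def)

lemma derivation_poly_sum: "derivation_poly d (sum f S) = (\<Sum>i\<in>S. derivation_poly d (f i))"
  by (induction S rule: infinite_finite_induct) (simp_all add: derivation_poly_add derivation_poly_0)

lemma derivation_poly_single_superset:
  assumes "finite S" "Poly_Mapping.keys mo \<subseteq> S"
  shows "derivation_poly d (Poly_Mapping.single mo c) = (\<Sum>v\<in>S.
        Poly_Mapping.single (mo - Poly_Mapping.single v 1) (of_nat (Poly_Mapping.lookup mo v) * c) * d v)"
proof -
  have "derivation_poly d (Poly_Mapping.single mo c) = (\<Sum>v\<in>Poly_Mapping.keys mo.
        Poly_Mapping.single (mo - Poly_Mapping.single v 1) (of_nat (Poly_Mapping.lookup mo v) * c) * d v)"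
    by (simp add: derivation_poly_def)
  also have "\<dots> = (\<Sum>v\<in>S.
        Poly_Mapping.single (mo - Poly_Mapping.single v 1) (of_nat (Poly_Mapping.lookup mo v) * c) * d v)"
    by (rule sum.mono_neutral_left) (use assms in \<open>auto simp: in_keys_iff\<close>)
  finally show ?thesis .
qed

text \<open>If \<open>v\<close> does not occur in \<open>a\<close>, the truncated difference \<open>a - v\<close> is the
  wrong exponent, but then its coefficient is \<open>0\<close>.\<close>

lemma derivation_poly_single_mult:
  "derivation_poly d (Poly_Mapping.single a c * Poly_Mapping.single b e) =
     derivation_poly d (Poly_Mapping.single a c) * Poly_Mapping.single b e +
     Poly_Mapping.single a c * derivation_poly d (Poly_Mapping.single b e)"
proof -
  let ?S = "Poly_Mapping.keys a \<union> Poly_Mapping.keys b"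
  let ?e = "\<lambda>v. Poly_Mapping.single v (Suc 0)"
  let ?l = Poly_Mapping.lookup
  have summand: "Poly_Mapping.single (a + b - ?e v) (of_nat (?l (a + b) v) * (c * e)) * d v =
      Poly_Mapping.single (a - ?e v) (of_nat (?l a v) * c) * d v * Poly_Mapping.single b e +
      Poly_Mapping.single a c * (Poly_Mapping.single (b - ?e v) (of_nat (?l b v) * e) * d v)" for v
  proof -
    have 1: "Poly_Mapping.single (a + b - ?e v) (of_nat (?l a v) * (c * e)) =
        Poly_Mapping.single (a - ?e v) (of_nat (?l a v) * c) * Poly_Mapping.single b e"
    proof (cases "?l a v = 0")
      case False
      then have "a + b - ?e v = (a - ?e v) + b"
        by (intro poly_mapping_eqI) (auto simp: lookup_add lookup_minus lookup_single when_def)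
      then show ?thesis by (simp add: mult_single ac_simps)
    qed simp
    have 2: "Poly_Mapping.single (a + b - ?e v) (of_nat (?l b v) * (c * e)) =
        Poly_Mapping.single a c * Poly_Mapping.single (b - ?e v) (of_nat (?l b v) * e)"
    proof (cases "?l b v = 0")
      case False
      then have "a + b - ?e v = a + (b - ?e v)"
        by (intro poly_mapping_eqI) (auto simp: lookup_add lookup_minus lookup_single when_def)
      then show ?thesis by (simp add: mult_single ac_simps)
    qed simp
    show ?thesis
      unfolding lookup_add of_nat_add distrib_right single_add 1 2 by (simp only: mult_ac)
  qed
  show ?thesis
    using keys_add[of a b]
    by (simp add: mult_single derivation_poly_single_superset[of ?S] summand sum.distrib
        sum_distrib_left sum_distrib_right)
qed

lemma derivation_poly_mult: "derivation_poly d (p * q) = derivation_poly d p * q + p * derivation_poly d q"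
proof -
  let ?s = "\<lambda>p mo. Poly_Mapping.single mo (Poly_Mapping.lookup p mo)"
  let ?D = "derivation_poly d"
  have s: "r = (\<Sum>mo\<in>Poly_Mapping.keys r. ?s r mo)" for r :: "'a cpoly"
    by (rule poly_sum_singles)
  have "p * q = (\<Sum>a\<in>Poly_Mapping.keys p. \<Sum>b\<in>Poly_Mapping.keys q. ?s p a * ?s q b)"
    by (subst (1) s[of p], subst (1) s[of q]) (simp add: sum_product)
  then have "?D (p * q) = (\<Sum>a\<in>Poly_Mapping.keys p. \<Sum>b\<in>Poly_Mapping.keys q. ?D (?s p a) * ?s q b)
      + (\<Sum>a\<in>Poly_Mapping.keys p. \<Sum>b\<in>Poly_Mapping.keys q. ?s p a * ?D (?s q b))"
    by (simp add: derivation_poly_sum derivation_poly_single_mult sum.distrib)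
  also have "\<dots> = ?D (\<Sum>a\<in>Poly_Mapping.keys p. ?s p a) * (\<Sum>a\<in>Poly_Mapping.keys q. ?s q a)
      + (\<Sum>a\<in>Poly_Mapping.keys p. ?s p a) * ?D (\<Sum>a\<in>Poly_Mapping.keys q. ?s q a)"
    by (simp add: derivation_poly_sum sum_product)
  finally show ?thesis by (simp flip: s)
qed

lemma derivation_poly_const: "derivation_poly d (const c) = 0"
  by (simp add: derivation_poly_def const_def)

lemma derivation_poly_var: "derivation_poly d (var v) = d v"
  by (simp add: derivation_poly_def var_def)

section \<open>Puiseux series with polynomial coefficients\<close>

text \<open>The derivative \<open>d/dz\<close> on series in \<open>u\<close> with \<open>z = u\<^sup>m\<close>: by the chain rule it is
  \<open>(1/m) u\<^sup>1\<^sup>-\<^sup>m d/du\<close>. In this form it is visibly a derivation.\<close>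

definition zdiff :: "nat \<Rightarrow> 'v cpoly fls \<Rightarrow> 'v cpoly fls" where
  "zdiff m F = fls_const (const (1 / of_nat m)) * (fls_X_intpow (1 - int m) * fls_deriv F)"

lemma zdiff_nth:
  assumes "0 < m"
  shows "fls_nth (zdiff m F) n = const ((of_int n + of_nat m) / of_nat m) * fls_nth F (n + int m)"
proof -
  have "fls_nth (zdiff m F) n = const (1 / of_nat m) * const (of_int (n + int m)) * fls_nth F (n + int m)"
    unfolding zdiff_def fls_X_intpow_times_conv_shift(1)
    by (simp add: const_hom const_of_int const_of_nat mult.assoc add.commute)
  also have "const (1 / of_nat m) * const (of_int (n + int m)) = const ((of_int n + of_nat m) / of_nat m)"
    by (simp flip: const_hom)
  finally show ?thesis .
qed

lemma zdiff_add: "zdiff m (F + G) = zdiff m F + zdiff m G"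
  by (simp add: zdiff_def algebra_simps)

lemma zdiff_mult: "zdiff m (F * G) = zdiff m F * G + F * zdiff m G"
  by (simp add: zdiff_def algebra_simps)

lemma zdiff_const: "zdiff m (fls_const c) = 0"
  by (simp add: zdiff_def)

lemma zdiff_scale: "zdiff m (fls_const c * F) = fls_const c * zdiff m F"
  by (simp add: zdiff_mult zdiff_const)

text \<open>The coefficient of \<open>z\<^sup>e\<close> in a series in \<open>u = z\<^sup>1\<^sup>/\<^sup>m\<close>, for any rational \<open>e\<close>.\<close>

definition puiseux_coeff :: "nat \<Rightarrow> 'v cpoly fls \<Rightarrow> rat \<Rightarrow> 'v cpoly" where
  "puiseux_coeff m F e =
     (if of_nat m * e \<in> \<int> then fls_nth F \<lfloor>of_nat m * e\<rfloor> else 0)"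

lemma puiseux_coeff_of_int:
  "0 < m \<Longrightarrow> puiseux_coeff m F (of_int n / of_nat m) = fls_nth F n"
  by (simp add: puiseux_coeff_def)

lemma puiseux_coeff_cases:
  assumes "0 < m"
  obtains n where "e = of_int n / of_nat m" "puiseux_coeff m F e = fls_nth F n"
    | "of_nat m * e \<notin> \<int>" "puiseux_coeff m F e = 0"
proof (cases "of_nat m * e \<in> \<int>")
  case True
  then obtain n where "of_nat m * e = of_int n" by (auto elim: Ints_cases)
  then have "e = of_int n / of_nat m" using assms by (simp add: field_simps)
  then show ?thesis using that(1)[of n] assms by (simp add: puiseux_coeff_of_int)
qed (use that(2) in \<open>simp add: puiseux_coeff_def\<close>)

lemma puiseux_coeff_0: "puiseux_coeff m 0 e = 0"
  by (simp add: puiseux_coeff_def)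

lemma puiseux_coeff_1: "0 < m \<Longrightarrow> puiseux_coeff m 1 e = (if e = 0 then 1 else 0)"
  by (rule puiseux_coeff_cases[of m e 1]) auto

lemma puiseux_coeff_add: "puiseux_coeff m (F + G) e = puiseux_coeff m F e + puiseux_coeff m G e"
  by (simp add: puiseux_coeff_def)

lemma puiseux_coeff_scale: "puiseux_coeff m (fls_const c * F) e = c * puiseux_coeff m F e"
  by (simp add: puiseux_coeff_def)

lemma puiseux_coeff_zdiff:
  assumes m: "0 < m"
  shows "puiseux_coeff m (zdiff m F) e = const (of_rat (e + 1)) * puiseux_coeff m F (e + 1)"
proof (rule puiseux_coeff_cases[of m e "zdiff m F"])
  fix n assume e: "e = of_int n / of_nat m" and "puiseux_coeff m (zdiff m F) e = fls_nth (zdiff m F) n"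
  moreover have "e + 1 = of_int (n + int m) / of_nat m" using m by (simp add: e field_simps)
  moreover have "of_rat (e + 1) = (of_int n + of_nat m) / (of_nat m :: complex)"
    using m by (simp add: e of_rat_add of_rat_divide field_simps)
  ultimately show ?thesis using m by (simp add: zdiff_nth puiseux_coeff_of_int del: of_int_add)
next
  assume 0: "of_nat m * e \<notin> \<int>" "puiseux_coeff m (zdiff m F) e = 0"
  then have "of_nat m * (e + 1) \<notin> \<int>"
    by (metis Ints_diff Ints_of_nat add_diff_cancel_right' distrib_left mult.right_neutral)
  then show ?thesis using 0 by (simp add: puiseux_coeff_def)
qed (rule m)

lemma puiseux_coeff_truncation: "0 < m \<Longrightarrow> \<exists>N. \<forall>e<N. puiseux_coeff m F e = 0"
proof (intro exI allI impI)
  fix e assume m: "0 < m" and e: "e < of_int (fls_subdegree F) / (of_nat m :: rat)"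
  show "puiseux_coeff m F e = 0"
    by (rule puiseux_coeff_cases[of m e F]) (use e m in \<open>auto simp: divide_less_cancel\<close>)
qed

text \<open>The Cauchy product may be summed over any finite set of exponents that
  contains all contributions. This freedom lets all terms of the Borcherds identity share one index set.\<close>

lemma puiseux_coeff_mult_finite:
  assumes m: "0 < m"
  shows "finite {a. puiseux_coeff m F a \<noteq> 0 \<and> puiseux_coeff m G (e - a) \<noteq> 0}" (is "finite ?S")
    and "finite S \<Longrightarrow> {a. puiseux_coeff m F a \<noteq> 0 \<and> puiseux_coeff m G (e - a) \<noteq> 0} \<subseteq> S \<Longrightarrow>
      puiseux_coeff m (F * G) e = (\<Sum>a\<in>S. puiseux_coeff m F a * puiseux_coeff m G (e - a))"
      (is "_ \<Longrightarrow> _ \<Longrightarrow> ?product S")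
proof -
  have "finite ?S \<and> (finite S \<longrightarrow> ?S \<subseteq> S \<longrightarrow> ?product S)" for S
  proof (rule puiseux_coeff_cases[of m e "F * G"])
    fix n assume e: "e = of_int n / of_nat m" and FG: "puiseux_coeff m (F * G) e = fls_nth (F * G) n"
    let ?I = "{fls_subdegree F..n - fls_subdegree G}"
    let ?q = "\<lambda>i. of_int i / (of_nat m :: rat)"
    have sub: "?S \<subseteq> ?q ` ?I"
    proof
      fix a assume a: "a \<in> ?S"
      then obtain i where i: "a = ?q i" "puiseux_coeff m F a = fls_nth F i"
        by (auto intro: puiseux_coeff_cases[OF m, of a F])
      have "e - a = ?q (n - i)" by (simp add: e i diff_divide_distrib)
      then have "puiseux_coeff m G (e - a) = fls_nth G (n - i)"
        using puiseux_coeff_of_int[OF m, of G "n - i"] by simp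
      then have "fls_subdegree F \<le> i" "fls_subdegree G \<le> n - i"
        using a i by (auto intro!: fls_subdegree_leI)
      then have "i \<in> ?I" by simp
      then show "a \<in> ?q ` ?I" using i by blast
    qed
    have prod_I: "?product (?q ` ?I)"
    proof -
      have inj: "inj_on ?q ?I" using m by (auto simp: inj_on_def)
      have "(\<Sum>a\<in>?q ` ?I. puiseux_coeff m F a * puiseux_coeff m G (e - a))
          = (\<Sum>i\<in>?I. fls_nth F i * fls_nth G (n - i))"
        unfolding sum.reindex[OF inj] o_def
        using puiseux_coeff_of_int[OF m, of G "n - _"]
        by (intro sum.cong) (simp_all add: e puiseux_coeff_of_int[OF m] flip: diff_divide_distrib of_int_diff)
      then show ?thesis by (simp add: FG fls_times_nth(2))
    qed
    have "?product S" if "finite S" "?S \<subseteq> S"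
    proof -
      have 0: "puiseux_coeff m F a * puiseux_coeff m G (e - a) = 0" if "a \<notin> ?S" for a
        using that by (cases "puiseux_coeff m F a = 0") auto
      have fin: "finite (S \<union> ?q ` ?I)" using that by simp
      have "(\<Sum>a\<in>S. puiseux_coeff m F a * puiseux_coeff m G (e - a))
          = (\<Sum>a\<in>S \<union> ?q ` ?I. puiseux_coeff m F a * puiseux_coeff m G (e - a))"
        using that(2) 0 by (intro sum.mono_neutral_left[OF fin]) blast+
      also have "\<dots> = (\<Sum>a\<in>?q ` ?I. puiseux_coeff m F a * puiseux_coeff m G (e - a))"
        using sub 0 by (intro sum.mono_neutral_right[OF fin]) blast+
      finally show ?thesis using prod_I by simp
    qed
    then show ?thesis using finite_subset[OF sub] by simp
  next
    assume e: "of_nat m * e \<notin> \<int>" and FG: "puiseux_coeff m (F * G) e = 0"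
    have "of_nat m * e = of_nat m * a + of_nat m * (e - a)" for a by (simp add: algebra_simps)
    then have "of_nat m * a \<notin> \<int> \<or> of_nat m * (e - a) \<notin> \<int>" for a using e Ints_add by metis
    then have 0: "puiseux_coeff m F a = 0 \<or> puiseux_coeff m G (e - a) = 0" for a
      by (auto simp: puiseux_coeff_def)
    then have "?product S" unfolding FG by (intro sum.neutral[symmetric]) (metis mult_zero_left mult_zero_right)
    moreover have "?S = {}" using 0 by blast
    ultimately show ?thesis by (simp only: finite.emptyI simp_thms)
  qed (rule m)
  then show "finite ?S" and "finite S \<Longrightarrow> ?S \<subseteq> S \<Longrightarrow> ?product S" by auto
qed

text \<open>The binomial coefficient here is the one that meets Vandermonde's identity
  in the proof of the Borcherds identity.\<close>

lemma puiseux_coeff_divided_power: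
  assumes m: "0 < m"
  shows "const (1 / fact j) * puiseux_coeff m ((zdiff m ^^ j) F) e =
    const (of_rat (e + of_nat j gchoose j)) * puiseux_coeff m F (e + of_nat j)"
proof (induction j arbitrary: e)
  case 0
  then show ?case by (simp add: const_hom)
next
  case (Suc j)
  let ?a = "e + 1 + of_nat j"
  have "const (1 / fact (Suc j)) * puiseux_coeff m ((zdiff m ^^ Suc j) F) e
      = const (of_rat ((e + 1) / of_nat (Suc j))) *
        (const (1 / fact j) * puiseux_coeff m ((zdiff m ^^ j) F) (e + 1))"
  proof -
    have "const (1 / fact (Suc j)) * const (of_rat (e + 1)) =
        const (of_rat ((e + 1) / of_nat (Suc j))) * (const (1 / fact j) :: 'a cpoly)"
      unfolding const_hom(4)[symmetric] by (simp add: of_rat_divide of_rat_add mult.commute)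
    then show ?thesis by (simp only: funpow.simps o_apply puiseux_coeff_zdiff[OF m] flip: mult.assoc)
  qed
  also have "\<dots> = const (of_rat ((e + 1) / of_nat (Suc j) * (?a gchoose j))) * puiseux_coeff m F ?a"
    unfolding Suc of_rat_mult const_hom(4) by (simp only: mult.assoc)
  also have "(e + 1) / of_nat (Suc j) * (?a gchoose j) = ?a gchoose Suc j"
  proof -
    have "(e + 1) * (?a gchoose j) = of_nat (Suc j) * (?a gchoose Suc j)"
      using gbinomial_absorb_comp[of ?a j] gbinomial_absorption[of j ?a] by simp
    then show ?thesis by (simp add: field_simps del: of_nat_Suc)
  qed
  finally show ?case by (simp add: add_ac)
qed

section \<open>The Borcherds identity for coefficients of series\<close>

text \<open>On the middle part \<open>0 \<le> j < L\<close> the binomial coefficient \<open>C(j, L)\<close> vanishes; the two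
  outer parts are the two kinds of products on the right of the Borcherds identity.\<close>

lemma sum_int_interval_split:
  fixes f :: "int \<Rightarrow> 'a::comm_monoid_add"
  shows "(\<Sum>j\<in>{- int N..<int L + int N}. f j) =
    (\<Sum>i<N. f (- 1 - int i)) + (\<Sum>j\<in>{0..<int L}. f j) + (\<Sum>i<N. f (int L + int i))"
proof -
  have split: "{- int N..<int L + int N} = (\<lambda>i. - 1 - int i) ` {..<N} \<union> {0..<int L} \<union> (\<lambda>i. int L + int i) ` {..<N}"
    (is "_ = ?A \<union> ?B \<union> ?C")
  proof (intro equalityI subsetI)
    fix j assume j: "j \<in> {- int N..<int L + int N}"
    consider "j < 0" | "0 \<le> j" "j < int L" | "int L \<le> j" by linarith
    then show "j \<in> ?A \<union> ?B \<union> ?C"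
    proof cases
      case 1
      then have "j = - 1 - int (nat (- 1 - j))" "nat (- 1 - j) < N" using j by auto
      then show ?thesis by blast
    next
      case 3
      then have "j = int L + int (nat (j - int L))" "nat (j - int L) < N" using j by auto
      then show ?thesis by blast
    qed simp
  qed auto
  have "inj_on (\<lambda>i. - 1 - int i) {..<N}" "inj_on (\<lambda>i. int L + int i) {..<N}"
    by (auto simp: inj_on_def)
  moreover have "?A \<inter> ?B = {}" "(?A \<union> ?B) \<inter> ?C = {}" by auto
  ultimately show ?thesis unfolding split by (simp add: sum.union_disjoint sum.reindex o_def)
qed

lemma gbinomial_neg_sign:
  "(of_int (- int L - 1) gchoose i) * (-1) ^ i = (of_nat (L + i) gchoose L :: 'a::field_char_0)"
proof -
  have "of_int (- int L - 1) = - (of_nat L + 1 :: 'a)" "of_nat L + 1 + of_nat i - 1 = (of_nat (L + i) :: 'a)"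
    by simp_all
  then have "(of_int (- int L - 1) gchoose i) = (-1) ^ i * (of_nat (L + i) gchoose i :: 'a)"
    by (simp only: gbinomial_minus)
  also have "(of_nat (L + i) gchoose i :: 'a) = of_nat (L + i) gchoose L"
    using gbinomial_of_nat_symmetric[of i "L + i", where 'a = 'a] by simp
  finally show ?thesis by simp
qed

lemma gbinomial_neg_nat: "(of_int (- 1 - int i) gchoose L) = (-1) ^ L * (of_nat (L + i) gchoose L :: 'a::field_char_0)"
proof -
  have "of_int (- 1 - int i) = - (of_nat i + 1 :: 'a)" "of_nat i + 1 + of_nat L - 1 = (of_nat (L + i) :: 'a)"
    by simp_all
  then show ?thesis by (simp only: gbinomial_minus)
qed

lemma of_rat_gbinomial: "of_rat (a gchoose n) = (of_rat a gchoose n :: 'a::field_char_0)"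
proof -
  have "of_rat (fact n) = (fact n :: 'a)" by (metis of_nat_fact of_rat_of_nat_eq)
  then show ?thesis by (simp add: gbinomial_prod_rev of_rat_divide of_rat_prod of_rat_diff)
qed

text \<open>The \<open>i\<close>-th terms of the two sides of the Borcherds identity, when \<open>F\<close> and \<open>G\<close> are the
  series of \<open>a\<close> and \<open>b\<close> and all coefficients act by multiplication. The product \<open>a\<^sub>(\<^sub>l\<^sub>+\<^sub>i\<^sub>) b\<close> is the divided
  derivative of \<open>a\<close> of order \<open>-l-i-1\<close>, times \<open>b\<close>, and is zero if this order is negative.\<close>

definition borcherds_left :: "nat \<Rightarrow> 'v cpoly fls \<Rightarrow> 'v cpoly fls \<Rightarrow> rat \<Rightarrow> rat \<Rightarrow> int \<Rightarrow> nat \<Rightarrow> 'v cpoly" where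
  "borcherds_left m F G p q l i = const (of_rat (p gchoose i)) *
     (if l + int i < 0
      then puiseux_coeff m (fls_const (const (1 / fact (nat (- (l + int i) - 1)))) *
             (zdiff m ^^ nat (- (l + int i) - 1)) F * G) (- (p + q - of_nat i) - 1)
      else 0)"

definition borcherds_right :: "nat \<Rightarrow> 'v cpoly fls \<Rightarrow> 'v cpoly fls \<Rightarrow> rat \<Rightarrow> rat \<Rightarrow> int \<Rightarrow> nat \<Rightarrow> 'v cpoly" where
  "borcherds_right m F G p q l i = const ((of_int l gchoose i) * (-1) ^ i) *
     (puiseux_coeff m F (- (of_int l + p - of_nat i) - 1) * puiseux_coeff m G (- (q + of_nat i) - 1) +
      const ((-1) powi (l + 1)) *
      (puiseux_coeff m G (- (of_int l + q - of_nat i) - 1) * puiseux_coeff m F (- (p + of_nat i) - 1)))"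

text \<open>The two products in each right-hand term occur with opposite signs in the terms \<open>i\<close>
  and \<open>l - i\<close>, because the coefficients commute.\<close>

lemma borcherds_nonneg:
  assumes "0 \<le> l"
  shows "borcherds_left m F G p q l i = 0"
    and "nat l < i \<Longrightarrow> borcherds_right m F G p q l i = 0"
    and "(\<Sum>i\<le>nat l. borcherds_right m F G p q l i) = 0"
proof -
  define n where "n = nat l"
  have l: "l = int n" using assms by (simp add: n_def)
  show "borcherds_left m F G p q l i = 0" using assms by (simp add: borcherds_left_def)
  show "nat l < i \<Longrightarrow> borcherds_right m F G p q l i = 0"
    by (simp add: l borcherds_right_def const_hom binomial_eq_0 flip: binomial_gbinomial)
  let ?f = "\<lambda>i. const (of_nat (n choose i) * (-1) ^ i) *
    (puiseux_coeff m F (- (of_nat n + p - of_nat i) - 1) * puiseux_coeff m G (- (q + of_nat i) - 1))"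
  have "l + 1 = int (Suc n)" by (simp add: l)
  then have powi: "(-1) powi (l + 1) = (- ((-1) ^ n) :: complex)"
    by (simp only: power_int_of_nat power_Suc) simp
  have "borcherds_right m F G p q l i = ?f i - ?f (n - i)" if "i \<le> n" for i
  proof -
    have "(-1) ^ (n - i) = ((-1) ^ n * (-1) ^ i :: complex)"
      using that by (auto simp: minus_one_power_iff)
    then have sign: "of_nat (n choose (n - i)) * (-1) ^ (n - i)
        = of_nat (n choose i) * (-1) ^ i * ((-1) ^ n :: complex)"
      by (simp only: binomial_symmetric[OF that, symmetric] mult_ac)
    have idx: "- (of_nat n + p - of_nat (n - i)) - 1 = - (p + of_nat i) - 1"
      "- (q + of_nat (n - i)) - 1 = - (of_nat n + q - of_nat i) - 1"
      using that by (simp_all add: of_nat_diff)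
    show ?thesis
      unfolding borcherds_right_def powi sign idx
      unfolding l of_int_of_nat_eq binomial_gbinomial[symmetric] const_hom
      by (simp add: algebra_simps)
  qed
  then have "(\<Sum>i\<le>nat l. borcherds_right m F G p q l i) = (\<Sum>i\<le>n. ?f i) - (\<Sum>i\<le>n. ?f (n - i))"
    by (simp add: n_def[symmetric] sum_subtractf)
  also have "(\<Sum>i\<le>n. ?f (n - i)) = (\<Sum>i\<le>n. ?f i)"
    by (rule sum.reindex_bij_witness[of _ "\<lambda>i. n - i" "\<lambda>i. n - i"]) auto
  finally show "(\<Sum>i\<le>nat l. borcherds_right m F G p q l i) = 0" by simp
qed

text \<open>With \<open>h(j) = F\<^sub>j\<^sub>-\<^sub>p G\<^sub>e\<^sub>-\<^sub>j\<^sub>+\<^sub>p\<close>, \<open>e = L - p - q - 1\<close>, both sides equal the sum of \<open>C(j, L) h(j)\<close> over the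
  integers. On the left the coefficient of \<open>h(j)\<close> is the sum of \<open>C(p, i) C(j - p, L - i)\<close>, equal to \<open>C(j, L)\<close> by
  Vandermonde; on the right the indices \<open>j \<ge> L\<close> and \<open>j < 0\<close> appear separately. Only integers \<open>j\<close>
  contribute because of the hypothesis on the exponents of \<open>F\<close>.\<close>

lemma borcherds_neg:
  fixes F G :: "'v cpoly fls"
  assumes m: "0 < m" and l: "l = - int L - 1"
    and F: "\<And>e. puiseux_coeff m F e \<noteq> 0 \<Longrightarrow> p + e \<in> \<int>"
  obtains N where "\<And>i. N \<le> i \<Longrightarrow> borcherds_left m F G p q l i = 0"
    and "\<And>i. N \<le> i \<Longrightarrow> borcherds_right m F G p q l i = 0"
    and "(\<Sum>i<N. borcherds_left m F G p q l i) = (\<Sum>i<N. borcherds_right m F G p q l i)"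
proof -
  let ?e = "of_nat L - p - q - 1"
  define h where "h j = puiseux_coeff m F (of_int j - p) * puiseux_coeff m G (?e - (of_int j - p))" for j
  let ?supp = "{j. puiseux_coeff m F (of_int j - p) \<noteq> 0 \<and> puiseux_coeff m G (?e - (of_int j - p)) \<noteq> 0}"
  have "(\<lambda>j. of_int j - p) ` ?supp \<subseteq>
      {a. puiseux_coeff m F a \<noteq> 0 \<and> puiseux_coeff m G (?e - a) \<noteq> 0}" by auto
  then have "finite ((\<lambda>j. of_int j - p) ` ?supp)"
    using puiseux_coeff_mult_finite(1)[OF m, of F G ?e] finite_subset by blast
  moreover have "inj_on (\<lambda>j. of_int j - p) ?supp" by (auto simp: inj_on_def)
  ultimately have "finite ?supp" using finite_imageD by blast
  then obtain M where M: "\<forall>j\<in>?supp. \<bar>j\<bar> \<le> M" using finite_abs_int_segment finite_int_segment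
    by (metis (no_types, lifting) bdd_above_def bdd_above_finite finite_imageI imageI)
  \<comment> \<open>Large enough for the support of \<open>h\<close> to lie between \<open>-N\<close> and \<open>L + N\<close>, and for all left terms to have index below \<open>N\<close>.\<close>
  define N where "N = nat (M + 1) + L + 1"
  have supp: "?supp \<subseteq> {- int N..<int L + int N}"
    using M unfolding N_def by fastforce
  have h_0: "h j = 0" if "j \<notin> {- int N..<int L + int N}" for j
  proof -
    have "j \<notin> ?supp" using supp that by blast
    then show ?thesis unfolding h_def by (cases "puiseux_coeff m F (of_int j - p) = 0") auto
  qed
  let ?W = "{- int N..<int L + int N}"
  have left: "borcherds_left m F G p q l i = (\<Sum>j\<in>?W. const (of_rat (p gchoose i)) *
      (const (of_rat ((of_int j - p) gchoose (L - i))) * h j))" if i: "i \<le> L" for i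
  proof -
    define k where "k = L - i"
    have k: "nat (- (l + int i) - 1) = k" "l + int i < 0" "int k = int L - int i"
      using i by (auto simp: l k_def)
    let ?D = "fls_const (const (1 / fact k)) * (zdiff m ^^ k) F"
    let ?e' = "- (p + q - of_nat i) - 1"
    have rk: "of_nat k = (of_nat L - of_nat i :: rat)" using i by (simp add: k_def of_nat_diff)
    have D: "puiseux_coeff m ?D e = const (of_rat (e + of_nat k gchoose k)) * puiseux_coeff m F (e + of_nat k)" for e
      by (simp add: puiseux_coeff_scale puiseux_coeff_divided_power[OF m])
    \<comment> \<open>Differentiating \<open>k\<close> times lowers exponents by \<open>k\<close>, so in terms of \<open>j\<close> the same set \<open>?W\<close> serves for all \<open>i\<close>.\<close>
    let ?s = "\<lambda>j. of_int j - p - of_nat k"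
    have "puiseux_coeff m (?D * G) ?e' = (\<Sum>a\<in>?s ` ?W. puiseux_coeff m ?D a * puiseux_coeff m G (?e' - a))"
    proof (rule puiseux_coeff_mult_finite(2)[OF m])
      show "{a. puiseux_coeff m ?D a \<noteq> 0 \<and> puiseux_coeff m G (?e' - a) \<noteq> 0} \<subseteq> ?s ` ?W"
      proof
        fix a assume a: "a \<in> {a. puiseux_coeff m ?D a \<noteq> 0 \<and> puiseux_coeff m G (?e' - a) \<noteq> 0}"
        then have Fa: "puiseux_coeff m F (a + of_nat k) \<noteq> 0" by (auto simp: D)
        then obtain j where j: "p + (a + of_nat k) = of_int j" using F by (auto elim: Ints_cases)
        then have a': "a + of_nat k = of_int j - p" "a = ?s j" by (auto simp: algebra_simps)
        have "?e - (of_int j - p) = ?e' - a" unfolding a'(1)[symmetric] by (simp add: rk)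
        then have "puiseux_coeff m G (?e - (of_int j - p)) \<noteq> 0" using a by (simp only: mem_Collect_eq not_False_eq_True)
        then have "j \<in> ?supp" using Fa unfolding a'(1) by (simp only: mem_Collect_eq simp_thms)
        then show "a \<in> ?s ` ?W" using supp a' by blast
      qed
    qed simp
    also have "\<dots> = (\<Sum>j\<in>?W. puiseux_coeff m ?D (?s j) * puiseux_coeff m G (?e' - ?s j))"
      by (subst sum.reindex) (auto simp: inj_on_def)
    also have "\<dots> = (\<Sum>j\<in>?W. const (of_rat ((of_int j - p) gchoose k)) * h j)"
    proof (rule sum.cong)
      fix j
      have idx: "?e' - ?s j = ?e - (of_int j - p)" "?s j + of_nat k = of_int j - p"
        by (simp_all add: rk)
      show "puiseux_coeff m ?D (?s j) * puiseux_coeff m G (?e' - ?s j)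
          = const (of_rat ((of_int j - p) gchoose k)) * h j"
        unfolding D idx h_def by (simp only: mult.assoc)
    qed simp
    finally show ?thesis using k by (simp add: borcherds_left_def sum_distrib_left k_def[symmetric])
  qed
  have left_0: "borcherds_left m F G p q l i = 0" if "L < i" for i
    using that by (simp add: borcherds_left_def l)
  have right: "borcherds_right m F G p q l i =
      const (of_nat (L + i) gchoose L) * (h (int L + int i) + const ((-1) ^ L) * h (- 1 - int i))" for i
  proof -
    have powi: "(-1) powi (- int L - 1 + 1) = ((-1) ^ L :: complex)"
      by (simp add: power_int_minus flip: power_inverse)
    have "- (of_int l + p - of_nat i) - 1 = of_int (int L + int i) - p"
      "- (q + of_nat i) - 1 = ?e - (of_int (int L + int i) - p)"
      "- (of_int l + q - of_nat i) - 1 = ?e - (of_int (- 1 - int i) - p)"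
      "- (p + of_nat i) - 1 = of_int (- 1 - int i) - p"
      by (simp_all add: l)
    then show ?thesis
      unfolding borcherds_right_def h_def powi l gbinomial_neg_sign by (simp only: mult.commute)
  qed
  have "(\<Sum>i<N. borcherds_left m F G p q l i) = (\<Sum>i\<le>L. borcherds_left m F G p q l i)"
    by (rule sum.mono_neutral_right) (auto simp: N_def left_0)
  also have "\<dots> = (\<Sum>i\<le>L. \<Sum>j\<in>?W. const (of_rat (p gchoose i)) *
      (const (of_rat ((of_int j - p) gchoose (L - i))) * h j))"
    by (simp add: left)
  also have "\<dots> = (\<Sum>j\<in>?W. \<Sum>i\<le>L. const (of_rat (p gchoose i)) *
      (const (of_rat ((of_int j - p) gchoose (L - i))) * h j))"
    by (rule sum.swap)
  also have "\<dots> = (\<Sum>j\<in>?W. const (of_int j gchoose L) * h j)"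
  proof (rule sum.cong)
    fix j
    have "(\<Sum>i\<le>L. const (of_rat (p gchoose i)) * (const (of_rat ((of_int j - p) gchoose (L - i))) * h j))
        = const (of_rat (\<Sum>i\<le>L. (p gchoose i) * ((of_int j - p) gchoose (L - i)))) * h j"
      by (simp add: of_rat_sum of_rat_mult const_sum const_hom sum_distrib_right mult.assoc)
    also have "(\<Sum>i\<le>L. (p gchoose i) * ((of_int j - p) gchoose (L - i))) = of_int j gchoose L"
      using gbinomial_Vandermonde[of p "of_int j - p" L] by (simp add: atMost_atLeast0)
    finally show "(\<Sum>i\<le>L. const (of_rat (p gchoose i)) * (const (of_rat ((of_int j - p) gchoose (L - i))) * h j))
        = const (of_int j gchoose L) * h j" by (simp add: of_rat_gbinomial)
  qed simp
  also have "\<dots> = (\<Sum>i<N. borcherds_right m F G p q l i)"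
  proof -
    have mid: "(\<Sum>j\<in>{0..<int L}. const (of_int j gchoose L) * h j) = 0"
    proof (rule sum.neutral, rule ballI)
      fix j assume j: "j \<in> {0..<int L}"
      have "(of_int j gchoose L) = (of_nat (nat j choose L) :: complex)"
        using j by (simp add: binomial_gbinomial)
      then show "const (of_int j gchoose L) * h j = 0"
        using j by (simp add: binomial_eq_0 nat_less_iff const_hom)
    qed
    have "const (of_int (- 1 - int i) gchoose L) * h (- 1 - int i) + const (of_int (int L + int i) gchoose L) * h (int L + int i)
        = borcherds_right m F G p q l i" for i
      unfolding right gbinomial_neg_nat
      by (simp add: const_hom algebra_simps)
    then show ?thesis
      by (simp add: sum_int_interval_split mid flip: sum.distrib)
  qed
  finally have sums: "(\<Sum>i<N. borcherds_left m F G p q l i) = (\<Sum>i<N. borcherds_right m F G p q l i)" .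
  have "borcherds_right m F G p q l i = 0" if "N \<le> i" for i
    using that h_0[of "int L + int i"] h_0[of "- 1 - int i"] by (simp add: right)
  moreover have "borcherds_left m F G p q l i = 0" if "N \<le> i" for i
    using that by (intro left_0) (simp add: N_def)
  ultimately show ?thesis using that sums by blast
qed

lemma borcherds_coeffs:
  fixes F G :: "'v cpoly fls"
  assumes m: "0 < m" and F: "\<And>e. puiseux_coeff m F e \<noteq> 0 \<Longrightarrow> p + e \<in> \<int>"
  obtains N where "\<And>i. N \<le> i \<Longrightarrow> borcherds_left m F G p q l i = 0"
    and "\<And>i. N \<le> i \<Longrightarrow> borcherds_right m F G p q l i = 0"
    and "(\<Sum>i<N. borcherds_left m F G p q l i) = (\<Sum>i<N. borcherds_right m F G p q l i)"
proof (cases "0 \<le> l")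
  case True
  show ?thesis
  proof (rule that[of "Suc (nat l)"])
    show "(\<Sum>i<Suc (nat l). borcherds_left m F G p q l i) = (\<Sum>i<Suc (nat l). borcherds_right m F G p q l i)"
      unfolding lessThan_Suc_atMost using borcherds_nonneg(1,3)[OF True, of m F G p q] by simp
  next
    fix i assume "Suc (nat l) \<le> i"
    then show "borcherds_right m F G p q l i = 0" by (intro borcherds_nonneg(2) True) simp
  qed (rule borcherds_nonneg(1)[OF True])
next
  case False
  then have "l = - int (nat (- l - 1)) - 1" by simp
  from borcherds_neg[OF m this F] that show ?thesis by blast
qed

section \<open>The series map on polynomials\<close>

text \<open>Ordinary jets are the case \<open>m = 1\<close>. Rewriting this \<open>1\<close> to \<open>Suc 0\<close> would keep lemmas about
  \<open>jet_vars k 1 (\<lambda>_. 0)\<close> and its quotient from applying.\<close>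

declare One_nat_def [simp del]

definition jet_deriv :: "(nat \<times> rat) cpoly \<Rightarrow> (nat \<times> rat) cpoly" where
  "jet_deriv = derivation_poly (\<lambda>(i, n). const (of_rat (- (n - 1))) * var (i, n - 1))"

definition jet_rot :: "nat \<Rightarrow> (nat \<Rightarrow> nat) \<Rightarrow> (nat \<times> rat) cpoly \<Rightarrow> (nat \<times> rat) cpoly" where
  "jet_rot m \<alpha> = eval_poly const (\<lambda>(i, n). const (unity_root m ^ \<alpha> i) * var (i, n))"

text \<open>The homomorphism that sends \<open>x\<^sub>i\<^sub>,\<^sub>-\<^sub>j\<close> to the divided derivative of order \<open>j\<close> of the universal
  twisted jet \<open>x\<^sub>i(z\<^sup>1\<^sup>/\<^sup>m)\<close>.\<close>

definition jet_hom :: "nat \<Rightarrow> nat \<Rightarrow> (nat \<Rightarrow> nat) \<Rightarrow> (nat \<times> rat) cpoly \<Rightarrow> (nat \<times> rat) cpoly fls" where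
  "jet_hom k m \<alpha> = eval_poly (\<lambda>c. fls_const (const c)) (\<lambda>(i, n).
     fls_const (const (1 / fact (nat \<lfloor>- n\<rfloor>))) *
       (zdiff m ^^ nat \<lfloor>- n\<rfloor>) (fps_to_fls (jet_series k m \<alpha> i)))"

abbreviation "untwisted_vars k \<equiv> jet_vars k 1 (\<lambda>_. 0)"

lemma jet_vars_untwisted: "(i, n) \<in> untwisted_vars k \<longleftrightarrow> i < k \<and> (\<exists>j::nat. n = - of_nat j)"
proof -
  have "n \<in> \<int> \<and> n \<le> 0 \<longleftrightarrow> (\<exists>j::nat. n = - of_nat j)"
  proof
    assume n: "n \<in> \<int> \<and> n \<le> 0"
    then obtain z where "n = of_int z" "z \<le> 0" by (auto elim: Ints_cases)
    then have "n = - of_nat (nat (- z))" by simp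
    then show "\<exists>j::nat. n = - of_nat j" ..
  qed auto
  then show ?thesis by (auto simp: jet_vars_def)
qed

lemma jet_hom_hom:
  "jet_hom k m \<alpha> (p + q) = jet_hom k m \<alpha> p + jet_hom k m \<alpha> q"
  "jet_hom k m \<alpha> (p * q) = jet_hom k m \<alpha> p * jet_hom k m \<alpha> q"
  "jet_hom k m \<alpha> (const c) = fls_const (const c)" "jet_hom k m \<alpha> 0 = 0" "jet_hom k m \<alpha> 1 = 1"
  by (simp_all add: jet_hom_def fls_hom.eval_poly_add fls_hom.eval_poly_mult fls_hom.eval_poly_const
      fls_hom.eval_poly_0 fls_hom.eval_poly_1)

lemma jet_hom_var: "jet_hom k m \<alpha> (var (i, - of_nat j)) =
    fls_const (const (1 / fact j)) * (zdiff m ^^ j) (fps_to_fls (jet_series k m \<alpha> i))"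
  by (simp add: jet_hom_def fls_hom.eval_poly_var)

lemma jet_rot_hom:
  "jet_rot m \<alpha> (p + q) = jet_rot m \<alpha> p + jet_rot m \<alpha> q"
  "jet_rot m \<alpha> (p * q) = jet_rot m \<alpha> p * jet_rot m \<alpha> q"
  "jet_rot m \<alpha> (const c) = const c" "jet_rot m \<alpha> 0 = 0" "jet_rot m \<alpha> 1 = 1"
  "jet_rot m \<alpha> (var (i, n)) = const (unity_root m ^ \<alpha> i) * var (i, n)"
  by (simp_all add: jet_rot_def const_hom.eval_poly_add const_hom.eval_poly_mult const_hom.eval_poly_const
      const_hom.eval_poly_0 const_hom.eval_poly_1 const_hom.eval_poly_var)

lemma jet_deriv_der:
  "jet_deriv (p + q) = jet_deriv p + jet_deriv q"
  "jet_deriv (p * q) = jet_deriv p * q + p * jet_deriv q"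
  "jet_deriv (const c) = 0" "jet_deriv 0 = 0"
  "jet_deriv (var (i, n)) = const (of_rat (1 - n)) * var (i, n - 1)"
  by (simp_all add: jet_deriv_def derivation_poly_add derivation_poly_mult derivation_poly_const
      derivation_poly_0 derivation_poly_var)

lemma jet_deriv_var: "jet_deriv (var (i, - of_nat j)) = const (of_nat (Suc j)) * var (i, - of_nat (Suc j))"
proof -
  have "1 - (- of_nat j) = (of_nat (Suc j) :: rat)" "- of_nat j - 1 = - (of_nat (Suc j) :: rat)" by simp_all
  then show ?thesis by (simp only: jet_deriv_der of_rat_of_nat_eq)
qed

lemma jet_deriv_1: "jet_deriv 1 = 0"
  using jet_deriv_der(3)[of 1] by (simp add: const_hom)

lemma jet_deriv_closed: "p \<in> polys (untwisted_vars k) \<Longrightarrow> jet_deriv p \<in> polys (untwisted_vars k)"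
proof (induction p rule: polys_induct)
  case (var v)
  then obtain i j where v: "v = (i, - of_nat j)" "i < k" by (cases v) (auto simp: jet_vars_untwisted)
  have "(i, - of_nat (Suc j)) \<in> untwisted_vars k" using v unfolding jet_vars_untwisted by blast
  then show ?case unfolding v jet_deriv_var by (intro polys_mult polys_const polys_var)
qed (simp_all add: jet_deriv_der polys_add polys_mult)

lemma jet_deriv_funpow_closed: "p \<in> polys (untwisted_vars k) \<Longrightarrow> (jet_deriv ^^ j) p \<in> polys (untwisted_vars k)"
  by (induction j) (simp_all add: jet_deriv_closed)

lemma jet_rot_closed: "p \<in> polys (untwisted_vars k) \<Longrightarrow> jet_rot m \<alpha> p \<in> polys (untwisted_vars k)"
proof (induction p rule: polys_induct)
  case (var v)
  then show ?case by (cases v) (simp add: jet_rot_hom polys_mult polys_var)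
qed (simp_all add: jet_rot_hom polys_add polys_mult)

text \<open>Both sides are derivations along \<open>jet_hom\<close>, so it is enough to compare them on the variables,
  where the identity \<open>(j + 1) / (j + 1)! = 1 / j!\<close> decides.\<close>

lemma jet_hom_deriv:
  assumes "p \<in> polys (untwisted_vars k)"
  shows "jet_hom k' m \<alpha> (jet_deriv p) = zdiff m (jet_hom k' m \<alpha> p)"
  using assms
proof (induction p rule: polys_induct)
  case (var v)
  then obtain i j where v: "v = (i, - of_nat j)" by (cases v) (auto simp: jet_vars_untwisted)
  have "const (of_nat (Suc j)) * const (1 / fact (Suc j)) = (const (1 / fact j) :: (nat \<times> rat) cpoly)"
    unfolding const_hom(4)[symmetric] by (simp add: divide_simps del: of_nat_Suc)
  then show ?case
    unfolding v jet_deriv_var jet_hom_hom jet_hom_var zdiff_scale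
    by (simp only: mult.assoc[symmetric] fls_const_mult_const funpow.simps o_apply)
qed (simp_all add: jet_deriv_der jet_hom_hom zdiff_const zdiff_add zdiff_mult)

lemma jet_hom_deriv_funpow:
  assumes "p \<in> polys (untwisted_vars k)"
  shows "jet_hom k' m \<alpha> ((jet_deriv ^^ j) p) = (zdiff m ^^ j) (jet_hom k' m \<alpha> p)"
  by (induction j) (simp_all add: jet_hom_deriv[OF jet_deriv_funpow_closed[OF assms]])

lemma zdiff_1: "zdiff 1 F = fls_deriv F"
  by (simp add: zdiff_def const_hom)

lemma const_fact: "const (fact j) = fact j"
  by (metis const_of_nat of_nat_fact)

lemma jet_series_nth: "fps_nth (jet_series k m \<alpha> i) e =
    (if (i, - (of_nat e / of_nat m)) \<in> jet_vars k m \<alpha> then var (i, - (of_nat e / of_nat m)) else 0)"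
  by (simp add: jet_series_def Let_def)

lemma jet_series_untwisted_nth: "i < k \<Longrightarrow> fps_nth (jet_series k 1 (\<lambda>_. 0) i) e = var (i, - of_nat e)"
  using jet_vars_untwisted[of i "- of_nat e" k] by (simp add: jet_series_nth)

text \<open>For ordinary jets no negative powers appear and the constant term of the series
  of \<open>p\<close> is \<open>p\<close> itself.\<close>

lemma jet_hom_untwisted_fps:
  assumes "p \<in> polys (untwisted_vars k)"
  shows "\<exists>H. jet_hom k 1 (\<lambda>_. 0) p = fps_to_fls H \<and> fps_nth H 0 = p"
  using assms
proof (induction p rule: polys_induct)
  case (const c)
  show ?case by (rule exI[of _ "fps_const (const c)"]) (simp add: jet_hom_hom)
next
  case (var v)
  then obtain i j where v: "v = (i, - of_nat j)" "i < k" by (cases v) (auto simp: jet_vars_untwisted)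
  let ?S = "jet_series k 1 (\<lambda>_. 0) i"
  have deriv: "(zdiff 1 ^^ j) (fps_to_fls ?S) = fps_to_fls ((fps_deriv ^^ j) ?S)" for j
    by (induction j) (simp_all only: funpow.simps o_apply id_apply zdiff_1 fls_deriv_fps_to_fls)
  have "const (1 / fact j) * (fact j * var (i, - of_nat j)) = var (i, - of_nat j)"
    by (simp flip: const_fact mult.assoc const_hom(4)) (simp add: const_hom)
  then show ?case
    unfolding v jet_hom_var deriv using jet_series_untwisted_nth[OF v(2), of j]
    by (intro exI[of _ "fps_const (const (1 / fact j)) * (fps_deriv ^^ j) ?S"])
      (simp add: fls_times_fps_to_fls fps_0th_higher_deriv)
next
  case (add p q)
  then obtain H K where "jet_hom k 1 (\<lambda>_. 0) p = fps_to_fls H" "fps_nth H 0 = p"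
    "jet_hom k 1 (\<lambda>_. 0) q = fps_to_fls K" "fps_nth K 0 = q" by blast
  then show ?case by (intro exI[of _ "H + K"]) (simp add: jet_hom_hom)
next
  case (mult p q)
  then obtain H K where "jet_hom k 1 (\<lambda>_. 0) p = fps_to_fls H" "fps_nth H 0 = p"
    "jet_hom k 1 (\<lambda>_. 0) q = fps_to_fls K" "fps_nth K 0 = q" by blast
  then show ?case by (intro exI[of _ "H * K"]) (simp add: jet_hom_hom fls_times_fps_to_fls)
qed

text \<open>For ordinary jets the homomorphism is \<open>p \<mapsto> e\<^sup>u\<^sup>T p\<close>: the \<open>j\<close>-th coefficient is the constant
  term of the \<open>j\<close>-th divided derivative, and the homomorphism turns \<open>d/du\<close> into \<open>T\<close>.\<close>

lemma jet_hom_untwisted_coeff: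
  assumes p: "p \<in> polys (untwisted_vars k)"
  shows "puiseux_coeff 1 (jet_hom k 1 (\<lambda>_. 0) p) e =
    (if e \<in> \<nat> then const (1 / fact (nat \<lfloor>e\<rfloor>)) * (jet_deriv ^^ nat \<lfloor>e\<rfloor>) p else 0)"
proof (cases "e \<in> \<nat>")
  case True
  then obtain j where e: "e = of_nat j" by (auto elim: Nats_cases)
  let ?H = "jet_hom k 1 (\<lambda>_. 0)"
  obtain H where H: "?H ((jet_deriv ^^ j) p) = fps_to_fls H" "fps_nth H 0 = (jet_deriv ^^ j) p"
    using jet_hom_untwisted_fps[OF jet_deriv_funpow_closed[OF p]] by blast
  have "const (1 / fact j) * puiseux_coeff 1 ((zdiff 1 ^^ j) (?H p)) 0 = puiseux_coeff 1 (?H p) e"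
    using puiseux_coeff_divided_power[of 1 j "?H p" 0] gbinomial_of_nat_symmetric[of j j, where 'a = rat]
    by (simp add: e const_hom)
  moreover have "puiseux_coeff 1 ((zdiff 1 ^^ j) (?H p)) 0 = (jet_deriv ^^ j) p"
    by (simp add: puiseux_coeff_def H flip: jet_hom_deriv_funpow[OF p])
  ultimately show ?thesis using True by (simp add: e)
next
  case False
  obtain H where H: "jet_hom k 1 (\<lambda>_. 0) p = fps_to_fls H"
    using jet_hom_untwisted_fps[OF p] by blast
  show ?thesis
  proof (cases "e \<in> \<int>")
    case True
    then obtain z where e: "e = of_int z" by (auto elim: Ints_cases)
    then have "z < 0" using False by (metis not_less of_int_of_nat_eq of_nat_in_Nats zero_le_imp_eq_int)
    then show ?thesis using False by (simp add: H puiseux_coeff_def e)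
  qed (use False in \<open>simp add: puiseux_coeff_def\<close>)
qed

lemma jet_hom_coeff_closed:
  assumes "p \<in> polys (untwisted_vars k')" and m: "0 < m"
  shows "fls_nth (jet_hom k m \<alpha> p) n \<in> polys (jet_vars k m \<alpha>)"
  using assms(1)
proof (induction p arbitrary: n rule: polys_induct)
  case (const c)
  show ?case by (simp add: jet_hom_hom)
next
  case (var v)
  then obtain i j where v: "v = (i, - of_nat j)" by (cases v) (auto simp: jet_vars_untwisted)
  have "fls_nth ((zdiff m ^^ j) (fps_to_fls (jet_series k m \<alpha> i))) n \<in> polys (jet_vars k m \<alpha>)" for n
  proof (induction j arbitrary: n)
    case 0
    then show ?case by (simp add: jet_series_nth polys_var)
  qed (simp add: zdiff_nth[OF m] polys_mult)
  then show ?case unfolding v jet_hom_var by (simp add: polys_mult)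
qed (simp_all add: jet_hom_hom polys_add fls_times_nth(2) polys_sum polys_mult)

lemma puiseux_coeff_closed: "(\<And>n. fls_nth F n \<in> S) \<Longrightarrow> 0 \<in> S \<Longrightarrow> puiseux_coeff m F e \<in> S"
  by (simp add: puiseux_coeff_def)

lemma puiseux_coeff_jet_series:
  assumes m: "0 < m" and i: "i < k"
  shows "puiseux_coeff m (fps_to_fls (jet_series k m \<alpha> i)) (- n) =
    (if n - of_nat (\<alpha> i) / of_nat m \<in> \<int> \<and> n \<le> 0 then var (i, n) else 0)"
proof (rule puiseux_coeff_cases[OF m, of "- n" "fps_to_fls (jet_series k m \<alpha> i)"])
  fix j assume j: "- n = of_int j / of_nat m"
    "puiseux_coeff m (fps_to_fls (jet_series k m \<alpha> i)) (- n) = fls_nth (fps_to_fls (jet_series k m \<alpha> i)) j"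
  have n: "n = - (of_int j / of_nat m)" using j(1) by (simp add: minus_equation_iff)
  show ?thesis
  proof (cases "0 \<le> j")
    case True
    then have "of_nat (nat j) = (of_int j :: rat)" by simp
    then have nth: "puiseux_coeff m (fps_to_fls (jet_series k m \<alpha> i)) (- n) =
        (if (i, n) \<in> jet_vars k m \<alpha> then var (i, n) else 0)"
      unfolding j(2) using True by (simp add: jet_series_nth n)
    show ?thesis unfolding nth by (simp add: jet_vars_def i)
  next
    case False
    then have "0 < n" using m by (simp add: n divide_neg_pos)
    then show ?thesis using False unfolding j(2) by simp
  qed
next
  assume "of_nat m * - n \<notin> \<int>" and 0: "puiseux_coeff m (fps_to_fls (jet_series k m \<alpha> i)) (- n) = 0"
  moreover have "of_nat m * - n \<in> \<int>" if "n - of_nat (\<alpha> i) / of_nat m \<in> \<int>"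
  proof -
    have "of_nat m * - n = - (of_nat m * (n - of_nat (\<alpha> i) / of_nat m)) - of_nat (\<alpha> i)"
      using m by (simp add: field_simps)
    then show ?thesis using that by simp
  qed
  ultimately show ?thesis by auto
qed

section \<open>The ideals of jets\<close>

lemma cring_poly_ring: "cring (poly_ring X)"
proof (intro cringI abelian_groupI comm_monoidI)
  fix p assume "p \<in> carrier (poly_ring X)"
  then show "\<exists>q\<in>carrier (poly_ring X). q \<oplus>\<^bsub>poly_ring X\<^esub> p = \<zero>\<^bsub>poly_ring X\<^esub>"
    by (intro bexI[of _ "- p"]) (simp_all add: polys_uminus)
qed (simp_all add: polys_add polys_mult algebra_simps)

lemma a_inv_poly_ring:
  assumes "p \<in> polys X"
  shows "\<ominus>\<^bsub>poly_ring X\<^esub> p = - p"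
proof -
  interpret cring "poly_ring X" by (rule cring_poly_ring)
  show ?thesis by (rule minus_equality) (simp_all add: assms polys_uminus)
qed

lemma poly_ideal_closed:
  assumes "ideal J (poly_ring X)"
  shows "J \<subseteq> polys X" "0 \<in> J" "a \<in> J \<Longrightarrow> b \<in> J \<Longrightarrow> a + b \<in> J"
    "p \<in> polys X \<Longrightarrow> a \<in> J \<Longrightarrow> p * a \<in> J" "a \<in> J \<Longrightarrow> - a \<in> J"
    "a \<in> J \<Longrightarrow> b \<in> J \<Longrightarrow> a - b \<in> J"
    "(\<And>i. i \<in> S \<Longrightarrow> f i \<in> J) \<Longrightarrow> sum f S \<in> J"
proof -
  interpret ideal J "poly_ring X" by (rule assms)
  show sub: "J \<subseteq> polys X" using a_subset by simp
  show 0: "0 \<in> J" using additive_subgroup.zero_closed[OF is_additive_subgroup] by simp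
  show add: "a \<in> J \<Longrightarrow> b \<in> J \<Longrightarrow> a + b \<in> J" for a b
    using additive_subgroup.a_closed[OF is_additive_subgroup, of a b] by simp
  show mult: "p \<in> polys X \<Longrightarrow> a \<in> J \<Longrightarrow> p * a \<in> J" for p a using I_l_closed by simp
  show uminus: "a \<in> J \<Longrightarrow> - a \<in> J" for a
    using mult[OF polys_uminus[OF polys_1], of a] by simp
  show "a \<in> J \<Longrightarrow> b \<in> J \<Longrightarrow> a - b \<in> J" using add[of a "- b"] uminus[of b] by simp
  show "(\<And>i. i \<in> S \<Longrightarrow> f i \<in> J) \<Longrightarrow> sum f S \<in> J"
    by (induction S rule: infinite_finite_induct) (simp_all add: 0 add)
qed

lemma poly_idealI:
  assumes sub: "J \<subseteq> polys X" and 0: "0 \<in> J"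
    and add: "\<And>a b. a \<in> J \<Longrightarrow> b \<in> J \<Longrightarrow> a + b \<in> J"
    and mult: "\<And>p a. p \<in> polys X \<Longrightarrow> a \<in> J \<Longrightarrow> p * a \<in> J"
  shows "ideal J (poly_ring X)"
proof -
  interpret cring "poly_ring X" by (rule cring_poly_ring)
  have uminus: "- a \<in> J" if "a \<in> J" for a
    using mult[OF polys_uminus[OF polys_1] that] by simp
  show ?thesis
  proof (rule idealI)
    show "ring (poly_ring X)" by (rule ring_axioms)
    show "subgroup J (add_monoid (poly_ring X))"
    proof (rule subgroup.intro)
      fix a assume a: "a \<in> J"
      then have "inv\<^bsub>add_monoid (poly_ring X)\<^esub> a = - a"
        using a_inv_poly_ring[of a X] sub unfolding a_inv_def by blast
      then show "inv\<^bsub>add_monoid (poly_ring X)\<^esub> a \<in> J" using uminus a by simp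
    qed (use sub 0 add in auto)
  next
    fix a x assume "a \<in> J" "x \<in> carrier (poly_ring X)"
    then show "x \<otimes>\<^bsub>poly_ring X\<^esub> a \<in> J" and "a \<otimes>\<^bsub>poly_ring X\<^esub> x \<in> J"
      using mult[of x a] by (simp_all add: mult.commute)
  qed
qed

lemma genideal_poly_ideal: "G \<subseteq> polys X \<Longrightarrow> ideal (Idl\<^bsub>poly_ring X\<^esub> G) (poly_ring X)"
proof -
  interpret cring "poly_ring X" by (rule cring_poly_ring)
  show "G \<subseteq> polys X \<Longrightarrow> ?thesis" by (rule genideal_ideal) simp
qed

lemma genideal_poly_self: "G \<subseteq> polys X \<Longrightarrow> G \<subseteq> Idl\<^bsub>poly_ring X\<^esub> G"
proof -
  interpret cring "poly_ring X" by (rule cring_poly_ring)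
  show "G \<subseteq> polys X \<Longrightarrow> ?thesis" by (rule genideal_self) simp
qed

text \<open>The elements that a homomorphism sends to series with coefficients in an ideal form an
  ideal. That a map respects the ideals of jets is therefore a question about generators.\<close>

lemma genideal_coeffs:
  assumes J: "ideal J (poly_ring Y)" and G: "G \<subseteq> polys X"
    and add: "\<And>p q. \<phi> (p + q) = \<phi> p + \<phi> q" and mult: "\<And>p q. \<phi> (p * q) = \<phi> p * \<phi> q"
    and closed: "\<And>p n. p \<in> polys X \<Longrightarrow> fls_nth (\<phi> p) n \<in> polys Y"
    and gens: "\<And>p n. p \<in> G \<Longrightarrow> fls_nth (\<phi> p) n \<in> J"
    and p: "p \<in> Idl\<^bsub>poly_ring X\<^esub> G"
  shows "fls_nth (\<phi> p) n \<in> J"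
proof -
  interpret cring "poly_ring X" by (rule cring_poly_ring)
  let ?K = "{p \<in> polys X. \<forall>n. fls_nth (\<phi> p) n \<in> J}"
  have 0: "\<phi> 0 = 0" using add[of 0 0] by simp
  have "ideal ?K (poly_ring X)"
  proof (rule poly_idealI)
    fix p a assume p: "p \<in> polys X" and a: "a \<in> ?K"
    have "fls_nth (\<phi> (p * a)) n \<in> J" for n
      unfolding mult fls_times_nth(2) using a closed[OF p] by (intro poly_ideal_closed[OF J]) auto
    then show "p * a \<in> ?K" using p a by (simp add: polys_mult)
  qed (auto simp: 0 add polys_add poly_ideal_closed[OF J])
  moreover have "G \<subseteq> ?K" using G gens by auto
  ultimately show ?thesis using genideal_minimal p by blast
qed

text \<open>The series \<open>P(x(t\<^sup>1\<^sup>/\<^sup>m))\<close>, whose coefficients generate the ideal of twisted jets.\<close>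

definition jet_relations :: "nat \<Rightarrow> nat \<Rightarrow> (nat \<Rightarrow> nat) \<Rightarrow> nat cpoly \<Rightarrow> (nat \<times> rat) cpoly fps" where
  "jet_relations k m \<alpha> = eval_poly (\<lambda>c. fps_const (const c)) (jet_series k m \<alpha>)"

text \<open>The polynomial \<open>P(x\<^sub>.\<^sub>,\<^sub>0)\<close>, the constant term of \<open>P(x(t))\<close>.\<close>

definition initial_jet :: "nat cpoly \<Rightarrow> (nat \<times> rat) cpoly" where
  "initial_jet = eval_poly const (\<lambda>i. var (i, 0))"

lemma polys_UNIV: "p \<in> polys UNIV"
  by (simp add: polys_def)

lemma jet_relations_hom:
  "jet_relations k m \<alpha> (P + Q) = jet_relations k m \<alpha> P + jet_relations k m \<alpha> Q"
  "jet_relations k m \<alpha> (P * Q) = jet_relations k m \<alpha> P * jet_relations k m \<alpha> Q"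
  "jet_relations k m \<alpha> (const c) = fps_const (const c)"
  "jet_relations k m \<alpha> (var i) = jet_series k m \<alpha> i"
  by (simp_all add: jet_relations_def fps_hom.eval_poly_add fps_hom.eval_poly_mult
      fps_hom.eval_poly_const fps_hom.eval_poly_var)

lemma initial_jet_hom:
  "initial_jet (P + Q) = initial_jet P + initial_jet Q"
  "initial_jet (P * Q) = initial_jet P * initial_jet Q"
  "initial_jet (const c) = const c" "initial_jet (var i) = var (i, 0)"
  by (simp_all add: initial_jet_def const_hom.eval_poly_add const_hom.eval_poly_mult
      const_hom.eval_poly_const const_hom.eval_poly_var)

lemma initial_jet_closed: "P \<in> polys {..<k} \<Longrightarrow> initial_jet P \<in> polys (untwisted_vars k)"
proof (induction P rule: polys_induct)
  case (var i)
  then have "(i, 0) \<in> untwisted_vars k" unfolding jet_vars_untwisted by (auto intro: exI[of _ 0])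
  then show ?case by (simp add: initial_jet_hom polys_var)
qed (simp_all add: initial_jet_hom polys_add polys_mult)

lemma jet_hom_initial_jet: "jet_hom k m \<alpha> (initial_jet P) = fps_to_fls (jet_relations k m \<alpha> P)"
proof (induction P rule: polys_induct[OF polys_UNIV])
  case (2 i)
  show ?case using jet_hom_var[of k m \<alpha> i 0] by (simp add: initial_jet_hom jet_relations_hom const_hom)
qed (simp_all add: initial_jet_hom jet_relations_hom jet_hom_hom fls_times_fps_to_fls)

lemma jet_relations_closed: "fps_nth (jet_relations k m \<alpha> P) e \<in> polys (jet_vars k m \<alpha>)"
proof (induction P arbitrary: e rule: polys_induct[OF polys_UNIV])
  case (2 i)
  show ?case by (simp add: jet_relations_hom jet_series_nth polys_var)
qed (simp_all add: jet_relations_hom polys_add polys_mult polys_sum fps_mult_nth)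

text \<open>The ideal of ordinary jets is generated by the divided derivatives of
  \<open>P(x\<^sub>.\<^sub>,\<^sub>0)\<close>: the series \<open>P(x(t))\<close> is the image of \<open>P(x\<^sub>.\<^sub>,\<^sub>0)\<close> under \<open>e\<^sup>t\<^sup>T\<close>.\<close>

lemma jet_relations_untwisted:
  assumes "P \<in> polys {..<k}"
  shows "fps_nth (jet_relations k 1 (\<lambda>_. 0) P) j = const (1 / fact j) * (jet_deriv ^^ j) (initial_jet P)"
  using jet_hom_untwisted_coeff[OF initial_jet_closed[OF assms], of "of_nat j"]
  by (simp add: jet_hom_initial_jet puiseux_coeff_def)

lemma jet_ideal_eq: "jet_ideal k m \<alpha> Ps = Idl\<^bsub>jet_poly_ring k m \<alpha>\<^esub>
    {fps_nth (jet_relations k m \<alpha> P) e | P e. P \<in> set Ps}"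
  by (simp add: jet_ideal_def jet_relations_def)

lemma jet_ideal_ideal: "ideal (jet_ideal k m \<alpha> Ps) (jet_poly_ring k m \<alpha>)"
  unfolding jet_ideal_eq by (rule genideal_poly_ideal) (auto simp: jet_relations_closed)

lemma jet_relations_in_ideal: "P \<in> set Ps \<Longrightarrow> fps_nth (jet_relations k m \<alpha> P) e \<in> jet_ideal k m \<alpha> Ps"
  unfolding jet_ideal_eq
  by (rule subsetD[OF genideal_poly_self]) (auto simp: jet_relations_closed)

text \<open>The ideal of jets depends only on the ideal of the scheme, not on its
  generators.\<close>

lemma jet_relations_genideal:
  assumes Ps: "set Ps \<subseteq> polys {..<k}" and Q: "Q \<in> Idl\<^bsub>poly_ring {..<k}\<^esub> (set Ps)"
  shows "fps_nth (jet_relations k m \<alpha> Q) e \<in> jet_ideal k m \<alpha> Ps"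
proof -
  have "fls_nth (fps_to_fls (jet_relations k m \<alpha> Q)) (int e) \<in> jet_ideal k m \<alpha> Ps"
    by (rule genideal_coeffs[OF jet_ideal_ideal Ps _ _ _ _ Q])
      (use poly_ideal_closed(2)[OF jet_ideal_ideal] in
        \<open>simp_all add: jet_relations_hom fls_times_fps_to_fls jet_relations_closed jet_relations_in_ideal\<close>)
  then show ?thesis by simp
qed

lemma zdiff_funpow_coeff_in_ideal:
  assumes m: "0 < m" and J: "ideal J (poly_ring X)" and "\<And>n. fls_nth F n \<in> J"
  shows "fls_nth ((zdiff m ^^ j) F) n \<in> J"
proof (induction j arbitrary: n)
  case (Suc j)
  then show ?case by (simp add: zdiff_nth[OF m] poly_ideal_closed[OF J])
qed (simp add: assms)

text \<open>A generator \<open>T\<^sup>e P(x\<^sub>.\<^sub>,\<^sub>0) / e!\<close> is sent to a divided derivative of \<open>P(x(z\<^sup>1\<^sup>/\<^sup>m))\<close>; the coefficients of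
  the latter are multiples of the relations of twisted jets.\<close>

lemma jet_hom_ideal:
  assumes Ps: "set Ps \<subseteq> polys {..<k}" and m: "0 < m" and p: "p \<in> jet_ideal k 1 (\<lambda>_. 0) Ps"
  shows "fls_nth (jet_hom k m \<alpha> p) n \<in> jet_ideal k m \<alpha> Ps"
proof -
  let ?J = "jet_ideal k m \<alpha> Ps"
  note J = jet_ideal_ideal[of k m \<alpha> Ps]
  show ?thesis
  proof (rule genideal_coeffs[OF J _ _ _ _ _ p[unfolded jet_ideal_eq]])
    fix r n assume "r \<in> {fps_nth (jet_relations k 1 (\<lambda>_. 0) P) e | P e. P \<in> set Ps}"
    then obtain P e where r: "r = fps_nth (jet_relations k 1 (\<lambda>_. 0) P) e" and P: "P \<in> set Ps" by auto
    then have P': "P \<in> polys {..<k}" using Ps by auto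
    have "fls_nth (fps_to_fls (jet_relations k m \<alpha> P)) n \<in> ?J" for n
      using P by (simp add: jet_relations_in_ideal poly_ideal_closed(2)[OF J])
    then have "fls_nth ((zdiff m ^^ e) (fps_to_fls (jet_relations k m \<alpha> P))) n \<in> ?J" for n
      by (rule zdiff_funpow_coeff_in_ideal[OF m J])
    moreover have "jet_hom k m \<alpha> r = fls_const (const (1 / fact e)) *
        (zdiff m ^^ e) (fps_to_fls (jet_relations k m \<alpha> P))"
      unfolding r jet_relations_untwisted[OF P']
      by (simp add: jet_hom_hom jet_hom_deriv_funpow[OF initial_jet_closed[OF P']] jet_hom_initial_jet)
    ultimately show "fls_nth (jet_hom k m \<alpha> r) n \<in> ?J"
      by (simp add: poly_ideal_closed(4)[OF J])
  qed (auto simp: jet_relations_closed jet_hom_hom jet_hom_coeff_closed[OF _ m])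
qed

text \<open>\<open>T p\<close> is the first coefficient of \<open>e\<^sup>u\<^sup>T p\<close>, so this is the previous lemma for ordinary jets.\<close>

lemma jet_deriv_ideal:
  assumes Ps: "set Ps \<subseteq> polys {..<k}" and p: "p \<in> jet_ideal k 1 (\<lambda>_. 0) Ps"
  shows "jet_deriv p \<in> jet_ideal k 1 (\<lambda>_. 0) Ps"
proof -
  have p': "p \<in> polys (untwisted_vars k)" using p poly_ideal_closed(1)[OF jet_ideal_ideal] by blast
  have "fls_nth (jet_hom k 1 (\<lambda>_. 0) p) 1 \<in> jet_ideal k 1 (\<lambda>_. 0) Ps"
    by (rule jet_hom_ideal[OF Ps _ p]) simp
  moreover have "fls_nth (jet_hom k 1 (\<lambda>_. 0) p) 1 = jet_deriv p"
    using jet_hom_untwisted_coeff[OF p', of 1] by (simp add: puiseux_coeff_def const_hom)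
  ultimately show ?thesis by simp
qed

lemma jet_rot_relations:
  assumes "P \<in> polys {..<k}"
  shows "jet_rot m \<alpha> (fps_nth (jet_relations k 1 (\<lambda>_. 0) P) e) = fps_nth (jet_relations k 1 (\<lambda>_. 0)
    (eval_poly const (\<lambda>i. const (unity_root m ^ \<alpha> i) * var i) P)) e"
  using assms
proof (induction P arbitrary: e rule: polys_induct)
  case (const c)
  show ?case by (simp add: jet_relations_hom const_hom.eval_poly_const jet_rot_hom)
next
  case (var i)
  then show ?case
    by (simp add: jet_relations_hom const_hom.eval_poly_var jet_rot_hom jet_series_untwisted_nth)
next
  case (mult p q)
  have sum: "jet_rot m \<alpha> (sum f S) = (\<Sum>i\<in>S. jet_rot m \<alpha> (f i))" for f :: "nat \<Rightarrow> _" and S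
    by (simp add: jet_rot_def const_hom.eval_poly_sum)
  show ?case
    by (simp add: jet_relations_hom const_hom.eval_poly_mult fps_mult_nth sum jet_rot_hom mult)
qed (simp add: jet_relations_hom const_hom.eval_poly_add jet_rot_hom)

lemma eval_poly_eval_poly:
  "eval_poly id y (eval_poly const x p) = eval_poly id (\<lambda>i. eval_poly id y (x i)) (p :: 'v cpoly)"
  unfolding id_def
  by (induction p rule: polys_induct[OF polys_UNIV])
    (simp_all add: const_hom.eval_poly_const id_hom.eval_poly_const const_hom.eval_poly_var id_hom.eval_poly_var
      const_hom.eval_poly_add id_hom.eval_poly_add const_hom.eval_poly_mult id_hom.eval_poly_mult)

text \<open>By the hypothesis the functions \<open>c\<^sub>i x\<^sub>i\<close> take at \<open>g v\<close> the values of \<open>x\<^sub>i\<close> at \<open>v\<close>. Substituting them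
  into \<open>P\<close> gives a polynomial whose value at \<open>g v\<close> is that of \<open>P\<close> at \<open>v\<close>, which is therefore \<open>g(P)\<close>.\<close>

lemma acts_to_diagonal:
  assumes "P \<in> polys {..<k}" and g: "g \<in> carrier_mat k k"
    and diagonal: "\<And>i. i < k \<Longrightarrow> acts_to k g (var i) (const (c i) * var i)"
  shows "acts_to k g P (eval_poly const (\<lambda>i. const (c i) * var i) P)"
proof -
  have "eval_poly id (vec_index (g *\<^sub>v v)) (eval_poly const (\<lambda>i. const (c i) * var i) P)
      = eval_poly id (vec_index v) P" if v: "v \<in> carrier_vec k" for v
    using assms(1) unfolding eval_poly_eval_poly unfolding id_def
  proof (induction P rule: polys_induct)
    case (var i)
    then show ?case using diagonal[of i] v
      unfolding acts_to_def id_def by (simp add: id_hom.eval_poly_var)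
  qed (simp_all add: id_hom.eval_poly_const id_hom.eval_poly_add id_hom.eval_poly_mult)
  moreover have "eval_poly const (\<lambda>i. const (c i) * var i) P \<in> polys {..<k}"
    using assms(1)
    by (induction P rule: polys_induct) (simp_all add: const_hom.eval_poly_const const_hom.eval_poly_var
        const_hom.eval_poly_add const_hom.eval_poly_mult polys_add polys_mult polys_var)
  ultimately show ?thesis using assms(1) by (simp add: acts_to_def)
qed

lemma jet_rot_ideal:
  assumes Ps: "set Ps \<subseteq> polys {..<k}"
    and inv: "\<And>P. P \<in> set Ps \<Longrightarrow>
      eval_poly const (\<lambda>i. const (unity_root m ^ \<alpha> i) * var i) P \<in> Idl\<^bsub>poly_ring {..<k}\<^esub> (set Ps)"
    and p: "p \<in> jet_ideal k 1 (\<lambda>_. 0) Ps"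
  shows "jet_rot m \<alpha> p \<in> jet_ideal k 1 (\<lambda>_. 0) Ps"
proof -
  let ?J = "jet_ideal k 1 (\<lambda>_. 0) Ps"
  note J = jet_ideal_ideal[of k 1 "\<lambda>_. 0" Ps]
  have "fls_nth (fls_const (jet_rot m \<alpha> p)) 0 \<in> ?J"
  proof (rule genideal_coeffs[OF J _ _ _ _ _ p[unfolded jet_ideal_eq]])
    fix r n assume "r \<in> {fps_nth (jet_relations k 1 (\<lambda>_. 0) P) e | P e. P \<in> set Ps}"
    then obtain P e where "r = fps_nth (jet_relations k 1 (\<lambda>_. 0) P) e" "P \<in> set Ps" by auto
    then have "jet_rot m \<alpha> r \<in> ?J"
      using Ps jet_rot_relations[of P k m \<alpha> e] jet_relations_genideal[OF Ps inv] by auto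
    then show "fls_nth (fls_const (jet_rot m \<alpha> r)) n \<in> ?J"
      by (simp add: poly_ideal_closed(2)[OF J])
  qed (auto simp: jet_relations_closed jet_rot_hom jet_rot_closed fls_plus_const)
  then show ?thesis by simp
qed

section \<open>Equivariance under the automorphism\<close>

lemma unity_root_power_int_eq_1:
  assumes m: "0 < m"
  shows "unity_root m powi n = 1 \<longleftrightarrow> int m dvd n"
proof -
  have "unity_root m = cis (2 * pi / of_nat m)"
    by (simp add: unity_root_def cis_conv_exp mult.commute)
  then have "unity_root m powi n = cis (of_int n * (2 * pi / of_nat m))"
    by (simp add: cis_power_int)
  also have "\<dots> = 1 \<longleftrightarrow> (\<exists>z. of_int n * (2 * pi / of_nat m) = of_int z * (2 * pi))"
    by (rule cis_eq_1_iff)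
  also have "\<dots> \<longleftrightarrow> (\<exists>z. n = int m * z)"
  proof (rule arg_cong[of _ _ Ex], rule ext)
    fix z
    have "of_int n * (2 * pi / of_nat m) = of_int z * (2 * pi) \<longleftrightarrow> (of_int n :: real) = of_int (int m * z)"
      using m by (simp add: field_simps)
    then show "(of_int n * (2 * pi / of_nat m) = of_int z * (2 * pi)) = (n = int m * z)"
      by (simp only: of_int_eq_iff)
  qed
  finally show ?thesis by (simp add: dvd_def)
qed

lemma unity_root_nonzero [simp]: "unity_root m \<noteq> 0"
  by (simp add: unity_root_def)

lemma unity_root_power_int_eq_power:
  assumes m: "0 < m"
  shows "unity_root m powi n = unity_root m ^ s \<longleftrightarrow> int m dvd n - int s"
  using unity_root_power_int_eq_1[OF m, of "n - int s"] by (simp add: power_int_diff)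

lemma unity_root_power_self: "0 < m \<Longrightarrow> unity_root m ^ m = 1"
  using unity_root_power_int_eq_1[of m "int m"] by simp

text \<open>The exponents of \<open>x\<^sub>i(z\<^sup>1\<^sup>/\<^sup>m)\<close> lie in \<open>-\<alpha>\<^sub>i/m + \<int>\<close>, and differentiating shifts them by
  integers.\<close>

lemma jet_series_diff_exponents:
  assumes m: "0 < m" and "fls_nth ((zdiff m ^^ j) (fps_to_fls (jet_series k m \<alpha> i))) n \<noteq> 0"
  shows "int m dvd - n - int (\<alpha> i)"
  using assms(2)
proof (induction j arbitrary: n)
  case 0
  then have n: "0 \<le> n" and "(i, - (of_nat (nat n) / of_nat m)) \<in> jet_vars k m \<alpha>"
    by (simp_all add: jet_series_nth split: if_splits)
  then have "- (of_nat (nat n) / of_nat m) - of_nat (\<alpha> i) / of_nat m \<in> (\<int> :: rat set)"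
    by (simp add: jet_vars_def)
  moreover have "- (of_nat (nat n) / of_nat m) - of_nat (\<alpha> i) / of_nat m = (of_int (- n - int (\<alpha> i)) / of_nat m :: rat)"
    using n by (simp add: diff_divide_distrib)
  ultimately obtain z :: int where "of_int (- n - int (\<alpha> i)) / of_nat m = (of_int z :: rat)"
    by (metis Ints_cases)
  then have "(of_int (- n - int (\<alpha> i)) :: rat) = of_int (int m * z)" using m by (simp add: field_simps)
  then have "- n - int (\<alpha> i) = int m * z" by (simp only: of_int_eq_iff)
  then show ?case by simp
next
  case (Suc j)
  then have "fls_nth ((zdiff m ^^ j) (fps_to_fls (jet_series k m \<alpha> i))) (n + int m) \<noteq> 0"
    by (auto simp: zdiff_nth[OF m])
  then have "int m dvd - (n + int m) - int (\<alpha> i)" by (rule Suc.IH)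
  moreover have "- n - int (\<alpha> i) = - (n + int m) - int (\<alpha> i) + int m" by simp
  ultimately show ?case by (simp only: dvd_add dvd_refl)
qed

text \<open>Equivariance: applying \<open>g\<close> to a polynomial multiplies the coefficient of \<open>u\<^sup>n\<close> in its series by
  \<open>\<xi>\<^sub>m\<^sup>-\<^sup>n\<close>. Both sides are multiplicative in \<open>p\<close>.\<close>

lemma jet_hom_rot:
  assumes "p \<in> polys (untwisted_vars k')" and m: "0 < m"
  shows "fls_nth (jet_hom k m \<alpha> (jet_rot m \<alpha> p)) n = const (unity_root m powi (- n)) * fls_nth (jet_hom k m \<alpha> p) n"
  using assms(1)
proof (induction p arbitrary: n rule: polys_induct)
  case (const c)
  show ?case by (simp add: jet_rot_hom jet_hom_hom const_hom)
next
  case (var v)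
  then obtain i j where v: "v = (i, - of_nat j)" by (cases v) (auto simp: jet_vars_untwisted)
  let ?S = "(zdiff m ^^ j) (fps_to_fls (jet_series k m \<alpha> i))"
  have "const (unity_root m ^ \<alpha> i) * fls_nth ?S n = const (unity_root m powi (- n)) * fls_nth ?S n"
    using jet_series_diff_exponents[OF m, of j k \<alpha> i n] unity_root_power_int_eq_power[OF m, of "- n" "\<alpha> i"]
    by (cases "fls_nth ?S n = 0") auto
  then show ?case
    unfolding v jet_rot_hom jet_hom_hom jet_hom_var by (simp add: mult.left_commute)
next
  case (mult p q)
  let ?F = "jet_hom k m \<alpha>" and ?\<xi> = "unity_root m"
  have unit_power: "const (?\<xi> powi (- i)) * const (?\<xi> powi (- (n - i))) = (const (?\<xi> powi (- n)) :: (nat \<times> rat) cpoly)" for i n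
    unfolding const_hom(4)[symmetric] power_int_add[OF disjI1[OF unity_root_nonzero], symmetric] by simp
  have coeff: "fls_nth (?F (jet_rot m \<alpha> p)) i * fls_nth (?F (jet_rot m \<alpha> q)) (n - i)
      = const (?\<xi> powi (- n)) * (fls_nth (?F p) i * fls_nth (?F q) (n - i))" for i
  proof -
    have "fls_nth (?F (jet_rot m \<alpha> p)) i * fls_nth (?F (jet_rot m \<alpha> q)) (n - i)
        = const (?\<xi> powi (- i)) * const (?\<xi> powi (- (n - i))) * (fls_nth (?F p) i * fls_nth (?F q) (n - i))"
      unfolding mult.IH by (simp only: ac_simps)
    then show ?thesis by (simp only: unit_power)
  qed
  \<comment> \<open>The factors are units, so both products are sums over the same range of indices.\<close>
  have deg: "fls_subdegree (?F (jet_rot m \<alpha> r)) = fls_subdegree (?F r)"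
    if "\<And>n. fls_nth (?F (jet_rot m \<alpha> r)) n = const (?\<xi> powi (- n)) * fls_nth (?F r) n" for r
  proof -
    have unit: "const (?\<xi> powi n) * const (?\<xi> powi (- n)) = (1 :: (nat \<times> rat) cpoly)" for n
      using unit_power[of "- n" 0] by (simp add: const_hom)
    have iff: "fls_nth (?F (jet_rot m \<alpha> r)) n = 0 \<longleftrightarrow> fls_nth (?F r) n = 0" for n
    proof
      assume "fls_nth (?F (jet_rot m \<alpha> r)) n = 0"
      then have "const (?\<xi> powi n) * (const (?\<xi> powi (- n)) * fls_nth (?F r) n) = 0"
        using that[of n] by simp
      then show "fls_nth (?F r) n = 0" by (simp only: mult.assoc[symmetric] unit mult_1_left)
    qed (simp add: that)
    show ?thesis
    proof (cases "?F r = 0")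
      case True
      then have "?F (jet_rot m \<alpha> r) = 0" using iff by (intro fls_zero_eqI) simp
      then show ?thesis using True by simp
    next
      case False
      then show ?thesis by (intro fls_subdegree_eqI) (simp_all add: iff)
    qed
  qed
  show ?case
    unfolding jet_rot_hom jet_hom_hom fls_times_nth(2) deg[OF mult.IH(1)] deg[OF mult.IH(2)]
    by (simp add: coeff sum_distrib_left)
qed (simp add: jet_rot_hom jet_hom_hom algebra_simps)

lemma jet_rot_funpow_hom:
  "(jet_rot m \<alpha> ^^ j) (p + q) = (jet_rot m \<alpha> ^^ j) p + (jet_rot m \<alpha> ^^ j) q"
  "(jet_rot m \<alpha> ^^ j) (p * q) = (jet_rot m \<alpha> ^^ j) p * (jet_rot m \<alpha> ^^ j) q"
  "(jet_rot m \<alpha> ^^ j) (const c) = const c"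
  "(jet_rot m \<alpha> ^^ j) (var (i, n)) = const ((unity_root m ^ \<alpha> i) ^ j) * var (i, n)"
  by (induction j) (simp_all add: jet_rot_hom const_hom mult_ac)

lemma jet_rot_order: "0 < m \<Longrightarrow> (jet_rot m \<alpha> ^^ m) p = p"
proof (induction p rule: polys_induct[OF polys_UNIV])
  case (2 v)
  have "(unity_root m ^ \<alpha> (fst v)) ^ m = 1"
    using unity_root_power_self[OF 2(2)] by (metis mult.commute power_mult power_one)
  then show ?case by (cases v) (simp add: jet_rot_funpow_hom const_hom)
qed (simp_all add: jet_rot_funpow_hom)

lemma jet_rot_deriv: "jet_rot m \<alpha> (jet_deriv p) = jet_deriv (jet_rot m \<alpha> p)"
  by (induction p rule: polys_induct[OF polys_UNIV])
    (auto simp: jet_rot_hom jet_deriv_der mult_ac)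

lemma jet_rot_deriv_funpow: "jet_rot m \<alpha> ((jet_deriv ^^ j) p) = (jet_deriv ^^ j) (jet_rot m \<alpha> p)"
  by (induction j) (simp_all add: jet_rot_deriv)

lemma jet_rot_sum: "jet_rot m \<alpha> (sum f S) = (\<Sum>i\<in>S. jet_rot m \<alpha> (f i))"
  by (simp add: jet_rot_def const_hom.eval_poly_sum)

text \<open>The projection to the eigenspace of a cyclic group: applying the automorphism
  shifts the sum over \<open>j\<close> by one, and the group has order \<open>m\<close>.\<close>

lemma jet_rot_eigen_average:
  fixes m s :: nat and \<alpha> :: "nat \<Rightarrow> nat" and p :: "(nat \<times> rat) cpoly"
  assumes m: "0 < m"
  defines "q \<equiv> const (1 / of_nat m) * (\<Sum>j<m. const (inverse (unity_root m ^ s) ^ j) * (jet_rot m \<alpha> ^^ j) p)"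
  shows "jet_rot m \<alpha> q = const (unity_root m ^ s) * q"
proof -
  let ?d = "inverse (unity_root m ^ s)"
  let ?f = "\<lambda>j. const (?d ^ j) * (jet_rot m \<alpha> ^^ j) p"
  have "?d ^ m = 1"
    using unity_root_power_self[OF m] by (metis inverse_1 power_commutes power_inverse power_mult power_one mult.commute)
  then have "?f m = ?f 0" by (simp add: jet_rot_order[OF m])
  then have shift: "(\<Sum>j<m. ?f (Suc j)) = (\<Sum>j<m. ?f j)"
    using sum.lessThan_Suc_shift[of ?f m] sum.lessThan_Suc[of ?f m] by simp
  have "unity_root m ^ s * ?d ^ Suc j = ?d ^ j" for j by (simp add: mult.assoc[symmetric])
  then have "const (?d ^ j) = const (unity_root m ^ s) * (const (?d ^ Suc j) :: (nat \<times> rat) cpoly)" for j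
    by (simp only: const_hom(4)[symmetric])
  then have "jet_rot m \<alpha> q = const (1 / of_nat m) * (\<Sum>j<m. const (unity_root m ^ s) * ?f (Suc j))"
    by (simp add: q_def jet_rot_hom jet_rot_sum mult.assoc)
  also have "\<dots> = const (unity_root m ^ s) * q"
    unfolding sum_distrib_left[symmetric] shift by (simp add: q_def mult.left_commute)
  finally show ?thesis .
qed

text \<open>By equivariance a nonzero coefficient of \<open>u\<^sup>n\<close> forces \<open>\<xi>\<^sub>m\<^sup>-\<^sup>n = \<xi>\<^sub>m\<^sup>s\<close>.\<close>

lemma jet_hom_eigen_exponents:
  assumes p: "p \<in> polys (untwisted_vars k')" and m: "0 < m"
    and eigen: "jet_rot m \<alpha> p = const (unity_root m ^ s) * p"
    and e: "puiseux_coeff m (jet_hom k m \<alpha> p) e \<noteq> 0"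
  shows "e + of_nat s / of_nat m \<in> \<int>"
proof (rule puiseux_coeff_cases[OF m, of e "jet_hom k m \<alpha> p"])
  fix n assume n: "e = of_int n / of_nat m" "puiseux_coeff m (jet_hom k m \<alpha> p) e = fls_nth (jet_hom k m \<alpha> p) n"
  let ?c = "fls_nth (jet_hom k m \<alpha> p) n"
  let ?d = "unity_root m powi (- n) - unity_root m ^ s"
  have "const ?d * ?c = 0"
    using jet_hom_rot[OF p m, of k \<alpha> n] unfolding eigen by (simp add: jet_hom_hom const_hom left_diff_distrib)
  then have "const (1 / ?d) * const ?d * ?c = 0" by (simp only: mult.assoc mult_zero_right)
  then have "const (1 / ?d * ?d) * ?c = 0" by (simp only: const_hom(4))
  then have "?d = 0" using e n by (cases "?d = 0") (simp_all add: const_hom(2))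
  then have "int m dvd - n - int s" using unity_root_power_int_eq_power[OF m] by simp
  then obtain z where "- n - int s = int m * z" by (elim dvdE)
  then have "n + int s = int m * (- z)" by simp
  then have "e + of_nat s / of_nat m = of_int (int m * (- z)) / of_nat m"
    unfolding n by (metis add_divide_distrib of_int_add of_int_of_nat_eq)
  then show ?thesis using m by simp
qed (use e in simp)

section \<open>Quotient algebras and series of multiplication operators\<close>

locale jet_quotient =
  fixes k m :: nat and \<alpha> :: "nat \<Rightarrow> nat" and Ps :: "nat cpoly list"
  assumes m_pos: "0 < m"
begin

abbreviation "Q \<equiv> jet_algebra k m \<alpha> Ps"
abbreviation "cls \<equiv> jet_class k m \<alpha> Ps"
abbreviation "J \<equiv> jet_ideal k m \<alpha> Ps"
abbreviation "X \<equiv> jet_vars k m \<alpha>"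

sublocale J: ideal J "jet_poly_ring k m \<alpha>"
  by (rule jet_ideal_ideal)

lemma jet_class_eq: "cls p = {j + p | j. j \<in> J}"
  by (auto simp: jet_class_def a_r_coset_def')

lemma jet_class_eq_iff:
  assumes "p \<in> polys X" "q \<in> polys X"
  shows "cls p = cls q \<longleftrightarrow> p - q \<in> J"
proof -
  have "p \<ominus>\<^bsub>jet_poly_ring k m \<alpha>\<^esub> q = p - q"
    using assms by (simp add: a_minus_def a_inv_poly_ring)
  then show ?thesis
    unfolding jet_class_def using J.quotient_eq_iff_same_a_r_cos[OF J.ideal_axioms, of p q] assms by simp
qed

lemma jet_algebra_carrier: "carrier Q = cls ` polys X"
  by (auto simp: jet_algebra_def Let_def FactRing_def A_RCOSETS_def' jet_class_def)

lemma jet_algebra_cls: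
  assumes "p \<in> polys X" "q \<in> polys X"
  shows "cls p \<otimes>\<^bsub>Q\<^esub> cls q = cls (p * q)" "cls p \<oplus>\<^bsub>Q\<^esub> cls q = cls (p + q)"
    "c \<odot>\<^bsub>Q\<^esub> cls q = cls (const c * q)"
  using assms J.rcoset_mult_add[of p q] J.a_rcos_sum[of p q] J.rcoset_mult_add[of "const c" q]
  by (simp_all add: jet_algebra_def Let_def FactRing_def jet_class_def)

lemma jet_algebra_one: "\<one>\<^bsub>Q\<^esub> = cls 1"
  by (simp add: jet_algebra_def Let_def FactRing_def jet_class_def)

lemma jet_algebra_zero: "\<zero>\<^bsub>Q\<^esub> = cls 0"
proof -
  have "\<zero>\<^bsub>Q\<^esub> = J" by (simp add: jet_algebra_def Let_def FactRing_def)
  then show ?thesis by (simp add: jet_class_eq)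
qed

lemma cls_carrier [simp, intro]: "p \<in> polys X \<Longrightarrow> cls p \<in> carrier Q"
  by (simp add: jet_algebra_carrier)

lemma carrierE: "v \<in> carrier Q \<Longrightarrow> (\<And>p. p \<in> polys X \<Longrightarrow> v = cls p \<Longrightarrow> thesis) \<Longrightarrow> thesis"
  by (auto simp: jet_algebra_carrier)

lemma cring_jet_algebra: "cring Q"
proof (intro cringI abelian_groupI comm_monoidI)
  fix x assume "x \<in> carrier Q"
  then obtain p where p: "p \<in> polys X" "x = cls p" by (rule carrierE)
  then show "\<exists>y\<in>carrier Q. y \<oplus>\<^bsub>Q\<^esub> x = \<zero>\<^bsub>Q\<^esub>"
    by (intro bexI[of _ "cls (- p)"]) (simp_all add: jet_algebra_cls jet_algebra_zero polys_uminus)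
qed (auto elim!: carrierE simp: jet_algebra_cls jet_algebra_one jet_algebra_zero polys_add polys_mult algebra_simps)

sublocale Q: cring Q
  by (rule cring_jet_algebra)

lemma vectorspace_jet_algebra: "vectorspace class_ring Q"
proof (intro vectorspace.intro moduleI)
  show field: "field (class_ring :: complex ring)" by (rule class_field)
  then show "cring (class_ring :: complex ring)" by (simp add: field_def domain_def)
qed (auto elim!: carrierE simp: jet_algebra_cls polys_add polys_mult Q.abelian_group_axioms const_hom algebra_simps)

lemma smult_mult:
  "p \<in> polys X \<Longrightarrow> v \<in> carrier Q \<Longrightarrow> c \<odot>\<^bsub>Q\<^esub> (cls p \<otimes>\<^bsub>Q\<^esub> v) = cls (const c * p) \<otimes>\<^bsub>Q\<^esub> v"
  by (auto elim!: carrierE simp: jet_algebra_cls polys_mult mult.assoc)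

lemma mult_mult: "p \<in> polys X \<Longrightarrow> q \<in> polys X \<Longrightarrow> v \<in> carrier Q \<Longrightarrow>
    cls p \<otimes>\<^bsub>Q\<^esub> (cls q \<otimes>\<^bsub>Q\<^esub> v) = cls (p * q) \<otimes>\<^bsub>Q\<^esub> v"
  by (auto elim!: carrierE simp: jet_algebra_cls polys_mult mult.assoc)

lemma add_mult: "p \<in> polys X \<Longrightarrow> q \<in> polys X \<Longrightarrow> v \<in> carrier Q \<Longrightarrow>
    cls p \<otimes>\<^bsub>Q\<^esub> v \<oplus>\<^bsub>Q\<^esub> cls q \<otimes>\<^bsub>Q\<^esub> v = cls (p + q) \<otimes>\<^bsub>Q\<^esub> v"
  by (auto elim!: carrierE simp: jet_algebra_cls polys_mult polys_add algebra_simps)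

lemma zero_mult: "v \<in> carrier Q \<Longrightarrow> cls 0 \<otimes>\<^bsub>Q\<^esub> v = \<zero>\<^bsub>Q\<^esub>"
  by (auto elim!: carrierE simp: jet_algebra_cls jet_algebra_zero)

lemma one_mult: "v \<in> carrier Q \<Longrightarrow> cls 1 \<otimes>\<^bsub>Q\<^esub> v = v"
  by (auto elim!: carrierE simp: jet_algebra_cls)

text \<open>A polynomial coefficient may lie in the ideal without being zero, so the support seen in the
  quotient can be smaller than that of \<open>h\<close>; any finite set containing the latter gives the sum.\<close>

lemma fsum_cls:
  assumes v: "v \<in> carrier Q" and h: "\<And>i. h i \<in> polys X"
    and S: "finite S" "\<And>i. i \<notin> S \<Longrightarrow> h i = 0"
  shows "fsum Q (\<lambda>i. cls (h i) \<otimes>\<^bsub>Q\<^esub> v) = cls (\<Sum>i\<in>S. h i) \<otimes>\<^bsub>Q\<^esub> v"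
proof -
  have "fsum Q (\<lambda>i. cls (h i) \<otimes>\<^bsub>Q\<^esub> v) = (\<Oplus>\<^bsub>Q\<^esub>i\<in>S. cls (h i) \<otimes>\<^bsub>Q\<^esub> v)"
    unfolding fsum_def
  proof (rule Q.add.finprod_mono_neutral_cong_left)
    show "{i. cls (h i) \<otimes>\<^bsub>Q\<^esub> v \<noteq> \<zero>\<^bsub>Q\<^esub>} \<subseteq> S"
      using S(2) zero_mult[OF v] by fastforce
  qed (use S v h in auto)
  also have "\<dots> = cls (\<Sum>i\<in>S. h i) \<otimes>\<^bsub>Q\<^esub> v"
    using S(1) by (induction S) (use v h in \<open>simp_all add: zero_mult add_mult polys_sum\<close>)
  finally show ?thesis .
qed

text \<open>The series of operators on the quotient in which each coefficient of \<open>F\<close> acts by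
  multiplication. The lemmas below translate the operations on operator series into ring operations on \<open>F\<close>.\<close>

definition mult_series :: "(nat \<times> rat) cpoly fls \<Rightarrow> (nat \<times> rat) cpoly set op_series" where
  "mult_series F e v = cls (puiseux_coeff m F e) \<otimes>\<^bsub>Q\<^esub> v"

definition coeffs_closed :: "(nat \<times> rat) cpoly fls \<Rightarrow> bool" where
  "coeffs_closed F \<longleftrightarrow> (\<forall>n. fls_nth F n \<in> polys X)"

lemma coeffs_closed_ops:
  "coeffs_closed F \<Longrightarrow> coeffs_closed G \<Longrightarrow> coeffs_closed (F + G)"
  "coeffs_closed F \<Longrightarrow> coeffs_closed G \<Longrightarrow> coeffs_closed (F * G)"
  "coeffs_closed (fls_const (const c))" "coeffs_closed 1"
  "coeffs_closed F \<Longrightarrow> coeffs_closed (zdiff m F)"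
  "coeffs_closed F \<Longrightarrow> coeffs_closed ((zdiff m ^^ j) F)"
  "coeffs_closed (fps_to_fls (jet_series k m \<alpha> i))"
proof -
  show zdiff: "coeffs_closed F \<Longrightarrow> coeffs_closed (zdiff m F)" for F
    by (simp add: coeffs_closed_def zdiff_nth[OF m_pos] polys_mult)
  show "coeffs_closed F \<Longrightarrow> coeffs_closed ((zdiff m ^^ j) F)" by (induction j) (simp_all add: zdiff)
qed (auto simp: coeffs_closed_def polys_add fls_times_nth(2) polys_mult polys_sum jet_series_nth polys_var)

lemma puiseux_coeff_closed': "coeffs_closed F \<Longrightarrow> puiseux_coeff m F e \<in> polys X"
  by (auto simp: coeffs_closed_def intro: puiseux_coeff_closed)

lemma mult_series_closed: "coeffs_closed F \<Longrightarrow> v \<in> carrier Q \<Longrightarrow> mult_series F e v \<in> carrier Q"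
  by (simp add: mult_series_def puiseux_coeff_closed')

lemma mult_series_module_hom: "coeffs_closed F \<Longrightarrow> mult_series F e \<in> module_hom class_ring Q Q"
  using puiseux_coeff_closed'[of F e]
  by (auto simp: module_hom_def mult_series_def jet_algebra_cls polys_add polys_mult algebra_simps elim!: carrierE)

lemma mult_series_mult:
  assumes F: "coeffs_closed F" and G: "coeffs_closed G" and v: "v \<in> carrier Q"
    and F': "\<And>e v. v \<in> carrier Q \<Longrightarrow> F' e v = mult_series F e v"
    and G': "\<And>e v. v \<in> carrier Q \<Longrightarrow> G' e v = mult_series G e v"
  shows "series_mult Q F' G' e v = mult_series (F * G) e v"
proof -
  let ?S = "{a. puiseux_coeff m F a \<noteq> 0 \<and> puiseux_coeff m G (e - a) \<noteq> 0}"
  have 0: "puiseux_coeff m F a * puiseux_coeff m G (e - a) = 0" if "a \<notin> ?S" for a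
    using that by (cases "puiseux_coeff m F a = 0") auto
  have "series_mult Q F' G' e v =
      fsum Q (\<lambda>a. cls (puiseux_coeff m F a * puiseux_coeff m G (e - a)) \<otimes>\<^bsub>Q\<^esub> v)"
    unfolding series_mult_def
    using F G v by (simp add: F' G' mult_series_closed mult_series_def mult_mult puiseux_coeff_closed')
  also have "\<dots> = cls (\<Sum>a\<in>?S. puiseux_coeff m F a * puiseux_coeff m G (e - a)) \<otimes>\<^bsub>Q\<^esub> v"
    by (rule fsum_cls[OF v _ puiseux_coeff_mult_finite(1)[OF m_pos] 0])
      (use F G in \<open>auto simp: polys_mult puiseux_coeff_closed'\<close>)
  finally show ?thesis
    by (simp only: mult_series_def puiseux_coeff_mult_finite(2)[OF m_pos puiseux_coeff_mult_finite(1)[OF m_pos] subset_refl])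
qed

lemma mult_series_one: "v \<in> carrier Q \<Longrightarrow> series_one Q e v = mult_series 1 e v"
  by (simp add: series_one_def mult_series_def puiseux_coeff_1[OF m_pos] one_mult zero_mult)

lemma mult_series_scale:
  "coeffs_closed F \<Longrightarrow> v \<in> carrier Q \<Longrightarrow> c \<odot>\<^bsub>Q\<^esub> mult_series F e v = mult_series (fls_const (const c) * F) e v"
  by (simp add: mult_series_def smult_mult puiseux_coeff_closed' puiseux_coeff_scale)

lemma mult_series_add:
  "coeffs_closed F \<Longrightarrow> coeffs_closed G \<Longrightarrow> v \<in> carrier Q \<Longrightarrow>
    mult_series F e v \<oplus>\<^bsub>Q\<^esub> mult_series G e v = mult_series (F + G) e v"
  by (simp add: mult_series_def add_mult puiseux_coeff_closed' puiseux_coeff_add)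

lemma mult_series_deriv:
  assumes "coeffs_closed F" and "v \<in> carrier Q"
    and F': "\<And>e v. v \<in> carrier Q \<Longrightarrow> F' e v = mult_series F e v"
  shows "(series_deriv Q ^^ j) F' e v = mult_series ((zdiff m ^^ j) F) e v"
  using assms(2)
proof (induction j arbitrary: e v)
  case (Suc j)
  then show ?case
    using assms(1) by (simp add: series_deriv_def mult_series_def smult_mult puiseux_coeff_zdiff[OF m_pos]
        puiseux_coeff_closed' coeffs_closed_ops)
qed (simp add: F')

lemma mult_series_prod_list:
  assumes F: "\<And>x. x \<in> set xs \<Longrightarrow> coeffs_closed (F x)"
    and F': "\<And>x e v. x \<in> set xs \<Longrightarrow> v \<in> carrier Q \<Longrightarrow> F' x e v = mult_series (F x) e v"
    and v: "v \<in> carrier Q"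
  shows "series_prod_list Q (map F' xs) e v = mult_series (prod_list (map F xs)) e v"
  using assms
proof (induction xs arbitrary: e v)
  case Nil
  then show ?case by (simp add: series_prod_list_def mult_series_one)
next
  case (Cons x xs)
  have "coeffs_closed (prod_list (map F xs))"
    using Cons.prems(1) by (induction xs) (auto intro: coeffs_closed_ops)
  moreover have "series_prod_list Q (map F' xs) e v = mult_series (prod_list (map F xs)) e v"
    if "v \<in> carrier Q" for e v
    using Cons that by auto
  ultimately show ?case
    using mult_series_mult[of "F x" "prod_list (map F xs)" v "F' x" "series_prod_list Q (map F' xs)" e] Cons.prems
    by (simp add: series_prod_list_def)
qed

end

text \<open>The maps of cosets in the definitions of \<open>T\<close> and of the automorphism are meaningful only for
  additive maps that preserve the ideal.\<close>

lemma (in jet_quotient) quot_map_cls: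
  assumes p: "p \<in> polys X"
    and f: "\<And>p. p \<in> polys X \<Longrightarrow> f p \<in> polys X"
    and add: "\<And>p q. f (p + q) = f p + f q" and J: "\<And>p. p \<in> J \<Longrightarrow> f p \<in> J"
  shows "quot_map (jet_poly_ring k m \<alpha>) J f (cls p) = cls (f p)"
proof -
  have "cls (f (j + p)) = cls (f p)" if "j \<in> J" for j
  proof -
    have "j \<in> polys X" using that poly_ideal_closed(1)[OF J.ideal_axioms] by blast
    then show ?thesis using that p by (simp add: jet_class_eq_iff f polys_add add J)
  qed
  then have "(\<lambda>p. cls (f p)) ` cls p = (\<lambda>_. cls (f p)) ` cls p"
    by (intro image_cong) (auto simp: jet_class_eq[of p])
  moreover have "p \<in> cls p"
    using poly_ideal_closed(2)[OF J.ideal_axioms] by (force simp: jet_class_eq[of p])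
  ultimately have "(\<lambda>p. cls (f p)) ` cls p = {cls (f p)}" by (simp add: image_constant)
  then show ?thesis by (simp add: quot_map_def jet_class_def)
qed

section \<open>The vertex algebra of jets and its action on twisted jets\<close>

lemma of_int_in_Nats: "(of_int z :: rat) \<in> \<nat> \<longleftrightarrow> 0 \<le> z"
proof
  assume "(of_int z :: rat) \<in> \<nat>"
  then obtain n where "(of_int z :: rat) = of_nat n" by (rule Nats_cases)
  then have "(0 :: rat) \<le> of_int z" by simp
  then show "0 \<le> z" by simp
next
  assume "0 \<le> z"
  then have "(of_int z :: rat) = of_nat (nat z)" by simp
  then show "(of_int z :: rat) \<in> \<nat>" by (metis of_nat_in_Nats)
qed

text \<open>\<open>V\<close> is the jet algebra that acts and \<open>M\<close> the algebra of twisted jets on which it acts.\<close>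

locale jet_module =
  V: jet_quotient k 1 "\<lambda>_. 0" Ps + M: jet_quotient k m \<alpha> Ps for k m \<alpha> Ps +
  assumes Ps_closed: "set Ps \<subseteq> polys {..<k}"
begin

lemma jet_T_cls: "p \<in> polys V.X \<Longrightarrow> jet_T k Ps (V.cls p) = V.cls (jet_deriv p)"
  unfolding jet_T_def jet_deriv_def[symmetric]
  by (rule V.quot_map_cls) (auto simp: jet_deriv_closed jet_deriv_der jet_deriv_ideal[OF Ps_closed])

lemma jet_T_funpow_cls: "p \<in> polys V.X \<Longrightarrow> (jet_T k Ps ^^ j) (V.cls p) = V.cls ((jet_deriv ^^ j) p)"
  by (induction j) (simp_all add: jet_T_cls jet_deriv_funpow_closed)

lemma jet_Y_cls:
  assumes "p \<in> polys V.X" "v \<in> carrier V.Q"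
  shows "jet_Y k Ps (V.cls p) e v = V.mult_series (jet_hom k 1 (\<lambda>_. 0) p) e v"
  using assms jet_deriv_funpow_closed[OF assms(1)]
  by (simp add: jet_Y_def V.mult_series_def jet_hom_untwisted_coeff jet_T_funpow_cls V.jet_algebra_cls
      V.zero_mult Let_def)

lemma jet_hom_closed: "p \<in> polys V.X \<Longrightarrow> M.coeffs_closed (jet_hom k m \<alpha> p)"
  by (simp add: M.coeffs_closed_def jet_hom_coeff_closed M.m_pos)

text \<open>\<open>Y\<close> is the map induced by \<open>jet_hom\<close> on classes. Only the values on the carrier are prescribed, so
  the vertex operators of the jet algebra itself also have this property for \<open>m = 1\<close>, and what is shown from
  it serves both the algebra and the module.\<close>

definition represents :: "((nat \<times> rat) cpoly set \<Rightarrow> (nat \<times> rat) cpoly set op_series) \<Rightarrow> bool" where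
  "represents Y \<longleftrightarrow> (\<forall>p\<in>polys V.X. \<forall>e. \<forall>v\<in>carrier M.Q.
     Y (V.cls p) e v = M.mult_series (jet_hom k m \<alpha> p) e v)"

text \<open>The map \<open>Y\<^sub>g\<close>. The choice of a representative does not affect the operators, as the next
  lemma shows.\<close>

definition twisted_Y :: "(nat \<times> rat) cpoly set \<Rightarrow> (nat \<times> rat) cpoly set op_series" where
  "twisted_Y a = M.mult_series (jet_hom k m \<alpha> (SOME p. p \<in> polys V.X \<and> a = V.cls p))"

text \<open>Two representatives of a class differ by an element of the ideal of jets, whose series has
  coefficients in the ideal of twisted jets.\<close>

lemma represents_twisted_Y: "represents twisted_Y"
  unfolding represents_def
proof (intro ballI allI)
  fix p e v assume p: "p \<in> polys V.X" and v: "v \<in> carrier M.Q"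
  define q where "q = (SOME q. q \<in> polys V.X \<and> V.cls p = V.cls q)"
  have "q \<in> polys V.X \<and> V.cls p = V.cls q"
    unfolding q_def by (rule someI[of _ p]) (simp add: p)
  then have q: "q \<in> polys V.X" "p - q \<in> V.J" using p V.jet_class_eq_iff[of p q] by blast+
  have "jet_hom k m \<alpha> p = jet_hom k m \<alpha> (p - q) + jet_hom k m \<alpha> q"
    by (simp flip: jet_hom_hom)
  then have "puiseux_coeff m (jet_hom k m \<alpha> p) e - puiseux_coeff m (jet_hom k m \<alpha> q) e
      = puiseux_coeff m (jet_hom k m \<alpha> (p - q)) e" by (simp add: puiseux_coeff_add)
  also have "\<dots> \<in> M.J"
    by (intro puiseux_coeff_closed jet_hom_ideal[OF Ps_closed M.m_pos q(2)]
        poly_ideal_closed(2)[OF M.J.ideal_axioms])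
  finally have "M.cls (puiseux_coeff m (jet_hom k m \<alpha> p) e) = M.cls (puiseux_coeff m (jet_hom k m \<alpha> q) e)"
    using M.jet_class_eq_iff M.puiseux_coeff_closed'[OF jet_hom_closed] p q(1) by blast
  then show "twisted_Y (V.cls p) e v = M.mult_series (jet_hom k m \<alpha> p) e v"
    by (simp add: twisted_Y_def q_def[symmetric] M.mult_series_def)
qed

context
  fixes Y assumes Y: "represents Y"
begin

lemma represents_cls: fixes e :: rat shows "p \<in> polys V.X \<Longrightarrow> v \<in> carrier M.Q \<Longrightarrow>
    Y (V.cls p) e v = M.mult_series (jet_hom k m \<alpha> p) e v"
  using Y by (simp add: represents_def)

lemma represents_series_map: "series_map m V.Q M.Q Y"
  unfolding series_map_def
proof (intro conjI ballI allI impI)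
  fix a and e :: rat assume "a \<in> carrier V.Q"
  then obtain p where p: "p \<in> polys V.X" "a = V.cls p" by (rule V.carrierE)
  have "Y a e v = M.mult_series (jet_hom k m \<alpha> p) e v" if "v \<in> carrier M.Q" for v
    using that p by (simp add: represents_cls)
  moreover have "M.mult_series (jet_hom k m \<alpha> p) e \<in> module_hom class_ring M.Q M.Q"
    by (intro M.mult_series_module_hom jet_hom_closed p)
  moreover have "r \<odot>\<^bsub>M.Q\<^esub> v \<in> carrier M.Q" if "v \<in> carrier M.Q" for r v
    using that by (auto elim!: M.carrierE simp: M.jet_algebra_cls polys_mult)
  ultimately show "Y a e \<in> module_hom class_ring M.Q M.Q"
    by (auto simp: module_hom_def Pi_iff)
next
  fix e :: rat and v assume v: "v \<in> carrier M.Q"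
  show "(\<lambda>a. Y a e v) \<in> module_hom class_ring V.Q M.Q"
    using v by (auto simp: module_hom_def V.jet_algebra_cls represents_cls polys_add polys_mult jet_hom_hom
        M.mult_series_closed M.mult_series_add M.mult_series_scale jet_hom_closed elim!: V.carrierE)
next
  fix a v and e :: rat assume "a \<in> carrier V.Q" "of_nat m * e \<notin> \<int>" "v \<in> carrier M.Q"
  then show "Y a e v = \<zero>\<^bsub>M.Q\<^esub>"
    by (auto simp: represents_cls M.mult_series_def puiseux_coeff_def M.zero_mult elim!: V.carrierE)
qed

lemma represents_truncation: "a \<in> carrier V.Q \<Longrightarrow> v \<in> carrier M.Q \<Longrightarrow> \<exists>N. \<forall>e<N. Y a e v = \<zero>\<^bsub>M.Q\<^esub>"
proof (erule V.carrierE)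
  fix p assume p: "p \<in> polys V.X" "a = V.cls p" and v: "v \<in> carrier M.Q"
  obtain N where "\<forall>e<N. puiseux_coeff m (jet_hom k m \<alpha> p) e = 0"
    using puiseux_coeff_truncation[OF M.m_pos] by blast
  then show ?thesis using p v
    by (intro exI[of _ N]) (simp add: represents_cls M.mult_series_def M.zero_mult)
qed

lemma represents_vacuum: "v \<in> carrier M.Q \<Longrightarrow> Y \<one>\<^bsub>V.Q\<^esub> e v = (if e = 0 then v else \<zero>\<^bsub>M.Q\<^esub>)"
  using M.mult_series_one[of v e]
  by (simp add: V.jet_algebra_one represents_cls jet_hom_hom series_one_def)

text \<open>After choosing representatives, both sides are multiplications by classes of sums of
  products of polynomials, and the identity is the one for coefficients of series.\<close>

lemma represents_borcherds:
  assumes p: "p \<in> polys V.X" and q: "q \<in> polys V.X"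
    and exps: "\<And>e. puiseux_coeff m (jet_hom k m \<alpha> p) e \<noteq> 0 \<Longrightarrow> x + e \<in> \<int>"
  shows "borcherds_identity (jet_Y k Ps) M.Q Y (V.cls p) (V.cls q) x y l"
  unfolding borcherds_identity_def
proof
  fix v assume v: "v \<in> carrier M.Q"
  let ?F = "jet_hom k m \<alpha> p" and ?G = "jet_hom k m \<alpha> q"
  let ?left = "borcherds_left m ?F ?G x y l" and ?right = "borcherds_right m ?F ?G x y l"
  note closed = M.puiseux_coeff_closed' M.coeffs_closed_ops jet_hom_closed p q polys_add polys_mult
  have left_closed: "?left i \<in> polys M.X" and right_closed: "?right i \<in> polys M.X" for i
    by (simp_all add: borcherds_left_def borcherds_right_def closed)
  have product: "mode (jet_Y k Ps (V.cls p)) (of_int l + of_nat i) (V.cls q) =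
      V.cls (if l + int i < 0 then const (1 / fact (nat (- (l + int i) - 1))) *
        (jet_deriv ^^ nat (- (l + int i) - 1)) p * q else 0)" for i
  proof -
    have e: "- (of_int l + of_nat i) - 1 = (of_int (- (l + int i) - 1) :: rat)" by simp
    have "(of_int (- (l + int i) - 1) :: rat) \<in> \<nat> \<longleftrightarrow> l + int i < 0"
      by (simp only: of_int_in_Nats) auto
    then show ?thesis using p q jet_deriv_funpow_closed[OF p]
      unfolding mode_def e
      by (simp add: jet_Y_cls V.mult_series_def jet_hom_untwisted_coeff V.jet_algebra_cls polys_mult
          del: of_int_diff of_int_minus of_int_add)
  qed
  have left: "of_rat (x gchoose i) \<odot>\<^bsub>M.Q\<^esub>
      mode (Y (mode (jet_Y k Ps (V.cls p)) (of_int l + of_nat i) (V.cls q))) (x + y - of_nat i) v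
      = M.cls (?left i) \<otimes>\<^bsub>M.Q\<^esub> v" for i
    unfolding product mode_def[of "Y _"] borcherds_left_def using v jet_deriv_funpow_closed[OF p] q p
    by (simp add: represents_cls polys_mult M.mult_series_def M.smult_mult jet_hom_hom
        jet_hom_deriv_funpow[OF p] closed puiseux_coeff_0)
  have right: "((of_int l gchoose i) * (-1) ^ i) \<odot>\<^bsub>M.Q\<^esub>
      (mode (Y (V.cls p)) (of_int l + x - of_nat i) (mode (Y (V.cls q)) (y + of_nat i) v) \<oplus>\<^bsub>M.Q\<^esub>
       ((-1) powi (l + 1)) \<odot>\<^bsub>M.Q\<^esub>
         mode (Y (V.cls q)) (of_int l + y - of_nat i) (mode (Y (V.cls p)) (x + of_nat i) v))
      = M.cls (?right i) \<otimes>\<^bsub>M.Q\<^esub> v" for i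
    unfolding mode_def borcherds_right_def using v p q
    by (simp add: represents_cls M.mult_series_def M.smult_mult M.mult_mult M.add_mult closed)
  obtain N where N: "\<And>i. N \<le> i \<Longrightarrow> ?left i = 0" "\<And>i. N \<le> i \<Longrightarrow> ?right i = 0"
    "(\<Sum>i<N. ?left i) = (\<Sum>i<N. ?right i)"
    using borcherds_coeffs[OF M.m_pos exps] by blast
  have "fsum M.Q (\<lambda>i. M.cls (?left i) \<otimes>\<^bsub>M.Q\<^esub> v) = fsum M.Q (\<lambda>i. M.cls (?right i) \<otimes>\<^bsub>M.Q\<^esub> v)"
    using M.fsum_cls[OF v left_closed, of "{..<N}"] M.fsum_cls[OF v right_closed, of "{..<N}"] N
    by (simp add: not_less)
  then show "fsum M.Q (\<lambda>i. of_rat (x gchoose i) \<odot>\<^bsub>M.Q\<^esub>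
      mode (Y (mode (jet_Y k Ps (V.cls p)) (of_int l + of_nat i) (V.cls q))) (x + y - of_nat i) v)
    = fsum M.Q (\<lambda>i. ((of_int l gchoose i) * (-1) ^ i) \<odot>\<^bsub>M.Q\<^esub>
      (mode (Y (V.cls p)) (of_int l + x - of_nat i) (mode (Y (V.cls q)) (y + of_nat i) v) \<oplus>\<^bsub>M.Q\<^esub>
       ((-1) powi (l + 1)) \<odot>\<^bsub>M.Q\<^esub>
         mode (Y (V.cls q)) (of_int l + y - of_nat i) (mode (Y (V.cls p)) (x + of_nat i) v)))"
    by (simp only: left right)
qed

end

text \<open>The jet algebra acts on itself by the construction for \<open>m = 1\<close>, so the axioms on
  truncation, vacuum and the Borcherds identity are those of the action. Translation covariance is the product
  rule for \<open>T\<close>.\<close>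

lemma vertex_algebra_jets: "vertex_algebra V.Q \<one>\<^bsub>V.Q\<^esub> (jet_T k Ps) (jet_Y k Ps)"
proof -
  interpret U: jet_module k 1 "\<lambda>_. 0" Ps
    by unfold_locales (rule Ps_closed)
  have Y: "U.represents (jet_Y k Ps)"
    by (simp add: U.represents_def jet_Y_cls)
  note closed = jet_deriv_closed U.jet_hom_closed V.puiseux_coeff_closed'
  show ?thesis
  proof (intro vertex_algebra.intro vertex_algebra_axioms.intro V.vectorspace_jet_algebra)
    show "series_map 1 V.Q V.Q (jet_Y k Ps)" by (rule U.represents_series_map[OF Y])
    show "\<one>\<^bsub>V.Q\<^esub> \<in> carrier V.Q" by simp
    show "jet_T k Ps \<in> module_hom class_ring V.Q V.Q"
      by (auto simp: module_hom_def V.jet_algebra_cls jet_T_cls polys_add polys_mult jet_deriv_closed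
          jet_deriv_der elim!: V.carrierE)
    show "\<exists>N. \<forall>e<N. jet_Y k Ps a e b = \<zero>\<^bsub>V.Q\<^esub>" if "a \<in> carrier V.Q" "b \<in> carrier V.Q" for a b
      by (rule U.represents_truncation[OF Y that])
    show "jet_Y k Ps \<one>\<^bsub>V.Q\<^esub> e b = (if e = 0 then b else \<zero>\<^bsub>V.Q\<^esub>)" if "b \<in> carrier V.Q" for b e
      by (rule U.represents_vacuum[OF Y that])
    show "jet_Y k Ps a e \<one>\<^bsub>V.Q\<^esub> = \<zero>\<^bsub>V.Q\<^esub>" if "a \<in> carrier V.Q" "e < 0" for a e
    proof -
      have "e \<notin> \<nat>" using that(2) by (auto elim: Nats_cases)
      then show ?thesis by (simp add: jet_Y_def)
    qed
    show "jet_Y k Ps a 0 \<one>\<^bsub>V.Q\<^esub> = a" if "a \<in> carrier V.Q" for a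
      using that by (auto simp: jet_Y_def V.jet_algebra_cls V.jet_algebra_one const_hom elim!: V.carrierE)
    show "jet_T k Ps \<one>\<^bsub>V.Q\<^esub> = \<zero>\<^bsub>V.Q\<^esub>"
      by (simp add: V.jet_algebra_one V.jet_algebra_zero jet_T_cls jet_deriv_1)
    show "borcherds_identity (jet_Y k Ps) V.Q (jet_Y k Ps) a b p q l"
      if ab: "a \<in> carrier V.Q" "b \<in> carrier V.Q" and "p \<in> \<int>" "q \<in> \<int>" for a b p q l
    proof -
      obtain x y where "x \<in> polys V.X" "a = V.cls x" "y \<in> polys V.X" "b = V.cls y"
        using ab by (metis V.carrierE)
      moreover have "p + e \<in> \<int>" if "puiseux_coeff 1 F e \<noteq> 0" for F :: "(nat \<times> rat) cpoly fls" and e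
        using that \<open>p \<in> \<int>\<close> by (auto simp: puiseux_coeff_def split: if_splits)
      ultimately show ?thesis using U.represents_borcherds[OF Y] by simp
    qed
    show "jet_T k Ps (jet_Y k Ps a e b) \<ominus>\<^bsub>V.Q\<^esub> jet_Y k Ps a e (jet_T k Ps b) = series_deriv V.Q (jet_Y k Ps a) e b"
      if ab: "a \<in> carrier V.Q" "b \<in> carrier V.Q" for a b e
    proof -
      obtain x y where x: "x \<in> polys V.X" "a = V.cls x" and y: "y \<in> polys V.X" "b = V.cls y"
        using ab by (metis V.carrierE)
      let ?c = "puiseux_coeff 1 (jet_hom k 1 (\<lambda>_. 0) x)"
      have T: "jet_deriv (?c e) = const (of_rat (e + 1)) * ?c (e + 1)"
      proof -
        have "const (of_rat (e + 1)) * ?c (e + 1) = puiseux_coeff 1 (jet_hom k 1 (\<lambda>_. 0) (jet_deriv x)) e"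
          by (simp add: jet_hom_deriv[OF x(1)] puiseux_coeff_zdiff)
        then show ?thesis
          by (simp add: jet_hom_untwisted_coeff x jet_deriv_closed jet_deriv_der funpow_swap1)
      qed
      have "jet_T k Ps (jet_Y k Ps a e b) = jet_Y k Ps a e (jet_T k Ps b) \<oplus>\<^bsub>V.Q\<^esub> series_deriv V.Q (jet_Y k Ps a) e b"
        using x y by (simp add: jet_Y_cls V.mult_series_def V.jet_algebra_cls jet_T_cls closed polys_mult
            jet_deriv_der T series_deriv_def mult.assoc add.commute)
      moreover have "jet_Y k Ps a e (jet_T k Ps b) \<in> carrier V.Q" "series_deriv V.Q (jet_Y k Ps a) e b \<in> carrier V.Q"
        using x y by (simp_all add: jet_Y_cls V.mult_series_def V.jet_algebra_cls jet_T_cls closed polys_mult series_deriv_def)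
      ultimately show ?thesis
        by (metis a_minus_def V.Q.a_assoc V.Q.a_comm V.Q.a_inv_closed V.Q.r_neg V.Q.r_zero)
    qed
  qed
qed

end

context jet_module
begin

definition generator_condition :: "((nat \<times> rat) cpoly set \<Rightarrow> (nat \<times> rat) cpoly set op_series) \<Rightarrow> bool" where
  "generator_condition Y \<longleftrightarrow> (\<forall>i<k. \<forall>n. \<forall>v\<in>carrier M.Q.
     Y (jet_monomial k Ps [(i, 0)]) (- n) v =
       (if n - of_nat (\<alpha> i) / of_nat m \<in> \<int> \<and> n \<le> 0
        then M.cls (var (i, n)) \<otimes>\<^bsub>M.Q\<^esub> v else \<zero>\<^bsub>M.Q\<^esub>))"

definition product_condition :: "((nat \<times> rat) cpoly set \<Rightarrow> (nat \<times> rat) cpoly set op_series) \<Rightarrow> bool" where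
  "product_condition Y \<longleftrightarrow> (\<forall>xs. (\<forall>(i, n)\<in>set xs. i < k \<and> n \<le> 0) \<longrightarrow>
     (\<forall>e. \<forall>v\<in>carrier M.Q. Y (jet_monomial k Ps xs) e v =
       series_prod_list M.Q
         (map (\<lambda>(i, n). series_scale M.Q (1 / fact (nat (- n)))
            ((series_deriv M.Q ^^ nat (- n)) (Y (jet_monomial k Ps [(i, 0)])))) xs) e v))"

definition monomial_poly :: "(nat \<times> int) list \<Rightarrow> (nat \<times> rat) cpoly" where
  "monomial_poly xs = prod_list (map (\<lambda>(i, n). var (i, of_int n)) xs)"

lemma jet_monomial_eq: "jet_monomial k Ps xs = V.cls (monomial_poly xs)"
  by (simp add: jet_monomial_def monomial_poly_def)

lemma monomial_poly_closed: "\<forall>(i, n)\<in>set xs. i < k \<and> n \<le> 0 \<Longrightarrow> monomial_poly xs \<in> polys V.X"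
proof (induction xs)
  case (Cons x xs)
  obtain i n where x: "x = (i, n)" by (cases x)
  then have n: "i < k" "of_int n = - (of_nat (nat (- n)) :: rat)" using Cons.prems by simp_all
  then have "(i, of_int n) \<in> V.X" unfolding jet_vars_untwisted by blast
  then show ?case using Cons by (simp add: monomial_poly_def x polys_mult polys_var)
qed (simp add: monomial_poly_def)

lemma jet_hom_monomial_poly:
  "\<forall>(i, n)\<in>set xs. i < k \<and> n \<le> 0 \<Longrightarrow> jet_hom k m \<alpha> (monomial_poly xs) =
    prod_list (map (\<lambda>(i, n). fls_const (const (1 / fact (nat (- n)))) *
      (zdiff m ^^ nat (- n)) (fps_to_fls (jet_series k m \<alpha> i))) xs)"
proof (induction xs)
  case (Cons x xs)
  obtain i n where x: "x = (i, n)" by (cases x)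
  then have n: "of_int n = - (of_nat (nat (- n)) :: rat)" using Cons.prems by simp
  have "jet_hom k m \<alpha> (var (i, of_int n)) = fls_const (const (1 / fact (nat (- n)))) *
      (zdiff m ^^ nat (- n)) (fps_to_fls (jet_series k m \<alpha> i))"
    unfolding n by (rule jet_hom_var)
  then show ?case using Cons by (simp add: monomial_poly_def x jet_hom_hom)
qed (simp add: monomial_poly_def jet_hom_hom)

lemma generator_condition_iff:
  "generator_condition Y \<longleftrightarrow> (\<forall>i<k. \<forall>e. \<forall>v\<in>carrier M.Q.
     Y (jet_monomial k Ps [(i, 0)]) e v = M.mult_series (fps_to_fls (jet_series k m \<alpha> i)) e v)"
proof -
  have "generator_condition Y \<longleftrightarrow> (\<forall>i<k. \<forall>n. \<forall>v\<in>carrier M.Q.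
     Y (jet_monomial k Ps [(i, 0)]) (- n) v = M.mult_series (fps_to_fls (jet_series k m \<alpha> i)) (- n) v)"
    unfolding generator_condition_def
    by (simp add: M.mult_series_def puiseux_coeff_jet_series M.m_pos if_distrib[of M.cls]
        if_distrib[of "\<lambda>x. x \<otimes>\<^bsub>M.Q\<^esub> _"] M.zero_mult cong: if_cong)
  then show ?thesis by (metis minus_minus)
qed

lemma product_of_generators:
  assumes Y: "generator_condition Y" and xs: "\<forall>(i, n)\<in>set xs. i < k \<and> n \<le> 0" and v: "v \<in> carrier M.Q"
  shows "series_prod_list M.Q
     (map (\<lambda>(i, n). series_scale M.Q (1 / fact (nat (- n)))
        ((series_deriv M.Q ^^ nat (- n)) (Y (jet_monomial k Ps [(i, 0)])))) xs) e v
    = M.mult_series (jet_hom k m \<alpha> (monomial_poly xs)) e v"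
  unfolding jet_hom_monomial_poly[OF xs]
proof (rule M.mult_series_prod_list[OF _ _ v])
  fix x assume "x \<in> set xs"
  then obtain i n where x: "x = (i, n)" "i < k" using xs by auto
  show "M.coeffs_closed (case x of (i, n) \<Rightarrow> fls_const (const (1 / fact (nat (- n)))) *
      (zdiff m ^^ nat (- n)) (fps_to_fls (jet_series k m \<alpha> i)))"
    unfolding x by (simp add: M.coeffs_closed_ops)
  fix e and v assume v: "v \<in> carrier M.Q"
  have gen: "Y (jet_monomial k Ps [(i, 0)]) e v = M.mult_series (fps_to_fls (jet_series k m \<alpha> i)) e v"
    if "v \<in> carrier M.Q" for e v
    using Y that x(2) unfolding generator_condition_iff by blast
  show "(case x of (i, n) \<Rightarrow> series_scale M.Q (1 / fact (nat (- n)))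
        ((series_deriv M.Q ^^ nat (- n)) (Y (jet_monomial k Ps [(i, 0)])))) e v =
      M.mult_series (case x of (i, n) \<Rightarrow> fls_const (const (1 / fact (nat (- n)))) *
        (zdiff m ^^ nat (- n)) (fps_to_fls (jet_series k m \<alpha> i))) e v"
    using v by (simp add: x series_scale_def M.mult_series_deriv[OF M.coeffs_closed_ops(7) v gen]
        M.mult_series_scale M.coeffs_closed_ops)
qed

lemma represents_generator:
  assumes Y: "represents Y" shows "generator_condition Y"
  unfolding generator_condition_iff
proof (intro allI impI ballI)
  fix i e v assume i: "i < k" and v: "v \<in> carrier M.Q"
  have "jet_hom k m \<alpha> (monomial_poly [(i, 0)]) = fps_to_fls (jet_series k m \<alpha> i)"
    using jet_hom_monomial_poly[of "[(i, 0)]"] i by (simp add: const_hom)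
  moreover have "monomial_poly [(i, 0)] \<in> polys V.X" using i by (intro monomial_poly_closed) simp
  ultimately show "Y (jet_monomial k Ps [(i, 0)]) e v = M.mult_series (fps_to_fls (jet_series k m \<alpha> i)) e v"
    using v by (simp add: jet_monomial_eq represents_cls[OF Y])
qed

lemma represents_product:
  assumes Y: "represents Y" shows "product_condition Y"
  unfolding product_condition_def
  using product_of_generators[OF represents_generator[OF Y]]
  by (simp add: jet_monomial_eq represents_cls[OF Y] monomial_poly_closed)

text \<open>The conditions on generators and on products fix the series of every monomial, and the
  monomials span the jet algebra.\<close>

lemma represents_unique:
  assumes hom: "series_map m V.Q M.Q Y" and gen: "generator_condition Y" and product: "product_condition Y"
  shows "represents Y"
  unfolding represents_def
proof (intro ballI allI)
  fix p and e :: rat and v assume p: "p \<in> polys V.X" and v: "v \<in> carrier M.Q"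
  have lin: "(\<lambda>a. Y a e v) \<in> module_hom class_ring V.Q M.Q"
    using hom v by (simp add: series_map_def)
  show "Y (V.cls p) e v = M.mult_series (jet_hom k m \<alpha> p) e v"
    using p
  proof (induction p rule: polys_monomial_induct)
    case (monomial vs)
    define xs where "xs = map (\<lambda>(i, n). (i, \<lfloor>n\<rfloor>)) vs"
    have xs: "\<forall>(i, n)\<in>set xs. i < k \<and> n \<le> 0"
      using monomial unfolding xs_def by (auto simp: jet_vars_untwisted dest!: subsetD)
    have "map (\<lambda>(i, n). var (i, of_int n)) xs = map var vs"
      using monomial unfolding xs_def by (auto simp: jet_vars_untwisted dest!: subsetD)
    then have "monomial_poly xs = prod_list (map var vs)" by (simp add: monomial_poly_def)
    moreover have "Y (jet_monomial k Ps xs) e v = M.mult_series (jet_hom k m \<alpha> (monomial_poly xs)) e v"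
      using product xs v product_of_generators[OF gen xs v] by (simp add: product_condition_def)
    ultimately show ?case by (simp add: jet_monomial_eq)
  next
    case (scale c p)
    have "Y (c \<odot>\<^bsub>V.Q\<^esub> V.cls p) e v = c \<odot>\<^bsub>M.Q\<^esub> Y (V.cls p) e v"
      using module_hom_smult[OF lin] scale by simp
    then show ?case using scale v
      by (simp add: V.jet_algebra_cls jet_hom_hom M.mult_series_scale jet_hom_closed)
  next
    case (add p q)
    have "Y (V.cls p \<oplus>\<^bsub>V.Q\<^esub> V.cls q) e v = Y (V.cls p) e v \<oplus>\<^bsub>M.Q\<^esub> Y (V.cls q) e v"
      using module_hom_add[OF lin] add by simp
    then show ?case using add v
      by (simp add: V.jet_algebra_cls jet_hom_hom M.mult_series_add jet_hom_closed)
  qed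
qed

end

section \<open>Twisted modules\<close>

text \<open>The substitution \<open>x\<^sub>i \<mapsto> \<xi>\<^sub>m\<^sup>\<alpha>\<^sup>i x\<^sub>i\<close> maps the ideal of the scheme to itself. This is
  what makes the automorphism of the jet algebra well defined.\<close>

locale twisted_jet_module = jet_module +
  assumes rot_relations: "\<And>P. P \<in> set Ps \<Longrightarrow>
      eval_poly const (\<lambda>i. const (unity_root m ^ \<alpha> i) * var i) P \<in> Idl\<^bsub>poly_ring {..<k}\<^esub> (set Ps)"
begin

abbreviation "\<sigma> \<equiv> jet_aut k m \<alpha> Ps"

lemma jet_rot_in_ideal: "p \<in> V.J \<Longrightarrow> jet_rot m \<alpha> p \<in> V.J"
  by (rule jet_rot_ideal[OF Ps_closed rot_relations])

lemma jet_aut_cls: "p \<in> polys V.X \<Longrightarrow> \<sigma> (V.cls p) = V.cls (jet_rot m \<alpha> p)"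
  unfolding jet_aut_def jet_rot_def[symmetric]
  by (rule V.quot_map_cls) (auto simp: jet_rot_closed jet_rot_hom jet_rot_in_ideal)

lemma jet_rot_funpow_closed: "p \<in> polys V.X \<Longrightarrow> (jet_rot m \<alpha> ^^ j) p \<in> polys V.X"
  by (induction j) (simp_all add: jet_rot_closed)

lemma jet_aut_funpow_cls: "p \<in> polys V.X \<Longrightarrow> (\<sigma> ^^ j) (V.cls p) = V.cls ((jet_rot m \<alpha> ^^ j) p)"
  by (induction j) (simp_all add: jet_aut_cls jet_rot_funpow_closed)

lemma jet_aut_order: "a \<in> carrier V.Q \<Longrightarrow> (\<sigma> ^^ m) a = a"
  by (auto simp: jet_aut_funpow_cls jet_rot_order M.m_pos elim!: V.carrierE)

lemma jet_aut_funpow_closed: "a \<in> carrier V.Q \<Longrightarrow> (\<sigma> ^^ j) a \<in> carrier V.Q"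
  by (auto simp: jet_aut_funpow_cls jet_rot_funpow_closed elim!: V.carrierE)

lemma jet_aut_bij: "bij_betw \<sigma> (carrier V.Q) (carrier V.Q)"
proof -
  have m: "Suc (m - 1) = m" using M.m_pos by simp
  have "(\<sigma> ^^ (m - 1)) (\<sigma> a) = (\<sigma> ^^ Suc (m - 1)) a" "\<sigma> ((\<sigma> ^^ (m - 1)) a) = (\<sigma> ^^ Suc (m - 1)) a" for a
    by (simp_all only: funpow.simps o_apply funpow_swap1)
  then have "(\<sigma> ^^ (m - 1)) (\<sigma> a) = (\<sigma> ^^ m) a" "\<sigma> ((\<sigma> ^^ (m - 1)) a) = (\<sigma> ^^ m) a" for a
    by (simp_all only: m)
  moreover have "\<sigma> a \<in> carrier V.Q" if "a \<in> carrier V.Q" for a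
    using jet_aut_funpow_closed[OF that, of "Suc 0"] by simp
  ultimately show ?thesis
    using jet_aut_order jet_aut_funpow_closed
    by (intro bij_betw_byWitness[where f' = "\<sigma> ^^ (m - 1)"]) auto
qed

lemma vertex_algebra_automorphism_jets:
  "vertex_algebra_automorphism V.Q \<one>\<^bsub>V.Q\<^esub> (jet_T k Ps) (jet_Y k Ps) \<sigma>"
proof (intro vertex_algebra_automorphism.intro vertex_algebra_automorphism_axioms.intro
    vertex_algebra_jets jet_aut_bij)
  show "\<sigma> \<in> module_hom class_ring V.Q V.Q"
    by (auto simp: module_hom_def V.jet_algebra_cls jet_aut_cls polys_add polys_mult jet_rot_closed
        jet_rot_hom elim!: V.carrierE)
  show "\<sigma> \<one>\<^bsub>V.Q\<^esub> = \<one>\<^bsub>V.Q\<^esub>"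
    by (simp add: V.jet_algebra_one jet_aut_cls jet_rot_hom)
  fix a b and n :: rat assume ab: "a \<in> carrier V.Q" "b \<in> carrier V.Q"
  obtain x y where x: "x \<in> polys V.X" "a = V.cls x" and y: "y \<in> polys V.X" "b = V.cls y"
    using ab by (metis V.carrierE)
  show "mode (jet_Y k Ps (\<sigma> a)) n (\<sigma> b) = \<sigma> (mode (jet_Y k Ps a) n b)"
    using x y by (simp add: mode_def jet_Y_cls jet_aut_cls jet_rot_closed V.mult_series_def V.jet_algebra_cls
        jet_hom_untwisted_coeff jet_deriv_funpow_closed polys_mult jet_rot_hom jet_rot_deriv_funpow)
qed

text \<open>A representative of an eigenvector need not be an eigenvector, and then its series may have
  exponents outside the expected coset, with coefficients that vanish only in the quotient. Averaging over the cyclic group gives a representative that is an eigenvector and has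
  the same class.\<close>

lemma eigenspace_representative:
  assumes "a \<in> eigenspace V.Q m \<sigma> s"
  obtains p where "p \<in> polys V.X" "a = V.cls p" "jet_rot m \<alpha> p = const (unity_root m ^ s) * p"
proof -
  let ?\<xi> = "unity_root m ^ s"
  obtain p where p: "p \<in> polys V.X" "a = V.cls p" using assms by (auto simp: eigenspace_def elim!: V.carrierE)
  have a: "(\<sigma> ^^ j) a = (?\<xi> ^ j) \<odot>\<^bsub>V.Q\<^esub> a" for j
  proof (induction j)
    case 0
    then show ?case using p by (simp add: V.jet_algebra_cls const_hom)
  next
    case (Suc j)
    have "\<sigma> ((?\<xi> ^ j) \<odot>\<^bsub>V.Q\<^esub> a) = (?\<xi> ^ j) \<odot>\<^bsub>V.Q\<^esub> \<sigma> a"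
      using p by (simp add: V.jet_algebra_cls jet_aut_cls polys_mult jet_rot_hom jet_rot_closed)
    also have "\<sigma> a = ?\<xi> \<odot>\<^bsub>V.Q\<^esub> a" using assms by (simp add: eigenspace_def)
    also have "(?\<xi> ^ j) \<odot>\<^bsub>V.Q\<^esub> (?\<xi> \<odot>\<^bsub>V.Q\<^esub> a) = (?\<xi> ^ Suc j) \<odot>\<^bsub>V.Q\<^esub> a"
      using p by (simp add: V.jet_algebra_cls polys_mult const_hom mult_ac)
    finally show ?case by (simp add: Suc)
  qed
  let ?d = "inverse ?\<xi>"
  let ?f = "\<lambda>j. const (?d ^ j) * (jet_rot m \<alpha> ^^ j) p"
  define q where "q = const (1 / of_nat m) * (\<Sum>j<m. ?f j)"
  have f_closed: "?f j \<in> polys V.X" for j by (simp add: polys_mult jet_rot_funpow_closed p)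
  have "?f j - p \<in> V.J" for j
  proof -
    have "V.cls (?f j) = (?d ^ j) \<odot>\<^bsub>V.Q\<^esub> ((\<sigma> ^^ j) a)"
      using p by (simp add: jet_aut_funpow_cls V.jet_algebra_cls jet_rot_funpow_closed)
    also have "\<dots> = V.cls (const (?d ^ j) * (const (?\<xi> ^ j) * p))"
      unfolding a using p by (simp add: V.jet_algebra_cls polys_mult)
    also have "const (?d ^ j) * (const (?\<xi> ^ j) * p) = p"
    proof -
      have "?d ^ j * ?\<xi> ^ j = 1" by (simp flip: power_mult_distrib)
      then have "const (?d ^ j) * const (?\<xi> ^ j) = (1 :: (nat \<times> rat) cpoly)"
        by (simp only: const_hom(4)[symmetric] const_hom(2))
      then show ?thesis by (simp only: mult.assoc[symmetric] mult_1_left)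
    qed
    finally show ?thesis using V.jet_class_eq_iff f_closed p by blast
  qed
  then have "const (1 / of_nat m) * (\<Sum>j<m. ?f j - p) \<in> V.J"
    by (intro poly_ideal_closed(4)[OF V.J.ideal_axioms polys_const] poly_ideal_closed(7)[OF V.J.ideal_axioms])
  also have "const (1 / of_nat m) * (\<Sum>j<m. ?f j - p) = q - p"
  proof -
    have "1 / of_nat m * of_nat m = (1 :: complex)" using M.m_pos by simp
    then have "const (1 / of_nat m) * of_nat m = (1 :: (nat \<times> rat) cpoly)"
      by (simp only: const_of_nat[symmetric] const_hom(4)[symmetric] const_hom(2))
    then have "const (1 / of_nat m) * (of_nat m * p) = p" by (simp only: mult.assoc[symmetric] mult_1_left)
    then show ?thesis by (simp add: q_def sum_subtractf right_diff_distrib)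
  qed
  finally have "q - p \<in> V.J" .
  moreover have q: "q \<in> polys V.X" unfolding q_def by (intro polys_mult polys_const polys_sum f_closed)
  ultimately have "a = V.cls q" using p V.jet_class_eq_iff by metis
  then show ?thesis using that q jet_rot_eigen_average[OF M.m_pos, where s = s and \<alpha> = \<alpha> and p = p] unfolding q_def by blast
qed

text \<open>Representing eigenvectors by polynomial eigenvectors puts the exponents of their series
  in \<open>-s/m + \<int>\<close>. That is the grading axiom and also the hypothesis under which the Borcherds identity for
  series holds.\<close>

lemma twisted_module_represents:
  assumes Y: "represents Y"
  shows "twisted_module V.Q \<one>\<^bsub>V.Q\<^esub> (jet_T k Ps) (jet_Y k Ps) \<sigma> M.Q m Y"
proof (intro twisted_module.intro twisted_module_axioms.intro vertex_algebra_automorphism_jets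
    M.vectorspace_jet_algebra M.m_pos jet_aut_order)
  show "series_map m V.Q M.Q Y" by (rule represents_series_map[OF Y])
  show "\<exists>N. \<forall>e<N. Y a e v = \<zero>\<^bsub>M.Q\<^esub>" if "a \<in> carrier V.Q" "v \<in> carrier M.Q" for a v
    by (rule represents_truncation[OF Y that])
  show "Y \<one>\<^bsub>V.Q\<^esub> e v = (if e = 0 then v else \<zero>\<^bsub>M.Q\<^esub>)" if "v \<in> carrier M.Q" for v e
    by (rule represents_vacuum[OF Y that])
  show "mode (Y a) n v = \<zero>\<^bsub>M.Q\<^esub>"
    if a: "a \<in> eigenspace V.Q m \<sigma> s" and v: "v \<in> carrier M.Q" and n: "n - of_nat s / of_nat m \<notin> \<int>" for s a v n
  proof -
    obtain p where p: "p \<in> polys V.X" "a = V.cls p" "jet_rot m \<alpha> p = const (unity_root m ^ s) * p"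
      using a by (rule eigenspace_representative)
    have "- n - 1 + of_nat s / of_nat m \<notin> \<int>"
    proof
      assume "- n - 1 + of_nat s / of_nat m \<in> \<int>"
      then have "- (- n - 1 + of_nat s / of_nat m) - 1 \<in> \<int>" by (intro Ints_diff Ints_minus) auto
      then show False using n by simp
    qed
    then have "puiseux_coeff m (jet_hom k m \<alpha> p) (- n - 1) = 0"
      using jet_hom_eigen_exponents[OF p(1) M.m_pos p(3)] by blast
    then show ?thesis using p v
      by (simp add: mode_def represents_cls[OF Y] M.mult_series_def M.zero_mult)
  qed
  show "borcherds_identity (jet_Y k Ps) M.Q Y a b x y l"
    if a: "a \<in> eigenspace V.Q m \<sigma> s" and b: "b \<in> eigenspace V.Q m \<sigma> s'"
      and x: "x - of_nat s / of_nat m \<in> \<int>" for s s' a b x y l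
  proof -
    obtain p where p: "p \<in> polys V.X" "a = V.cls p" "jet_rot m \<alpha> p = const (unity_root m ^ s) * p"
      using a by (rule eigenspace_representative)
    obtain q where q: "q \<in> polys V.X" "b = V.cls q"
      using b by (rule eigenspace_representative)
    show ?thesis unfolding p(2) q(2)
    proof (rule represents_borcherds[OF Y p(1) q(1)])
      fix e assume "puiseux_coeff m (jet_hom k m \<alpha> p) e \<noteq> 0"
      then have "e + of_nat s / of_nat m \<in> \<int>"
        by (rule jet_hom_eigen_exponents[OF p(1) M.m_pos p(3)])
      then have "(x - of_nat s / of_nat m) + (e + of_nat s / of_nat m) \<in> \<int>" using x by (rule Ints_add[rotated])
      then show "x + e \<in> \<int>" by simp
    qed
  qed
qed

end

theorem theorem4p1:
  fixes k m :: nat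
    and Ps :: "nat cpoly list"
    and g :: "complex mat"
    and \<alpha> :: "nat \<Rightarrow> nat"
  defines "A \<equiv> jet_VA k Ps"
    and "B \<equiv> jet_algebra k m \<alpha> Ps"
    and "I \<equiv> Idl\<^bsub>poly_ring {..<k}\<^esub> (set Ps)"
  assumes Ps: "set Ps \<subseteq> carrier (poly_ring {..<k})"
    and g: "g \<in> carrier_mat k k" "invertible_mat g"
    and order: "has_order k g m"
    and preserves: "{h. \<exists>f\<in>I. acts_to k g f h} = I"
    and \<alpha>_bound: "\<And>i. i < k \<Longrightarrow> \<alpha> i \<le> m - 1"
    and diagonal: "\<And>i. i < k \<Longrightarrow> acts_to k g (var i) (const (unity_root m ^ \<alpha> i) * var i)"
  defines "is_Yg \<equiv> \<lambda>Y. series_map m A B Y \<and>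
      (\<forall>i<k. \<forall>n. \<forall>v\<in>carrier B.
         Y (jet_monomial k Ps [(i, 0)]) (- n) v =
           (if n - of_nat (\<alpha> i) / of_nat m \<in> \<int> \<and> n \<le> 0
            then jet_class k m \<alpha> Ps (var (i, n)) \<otimes>\<^bsub>B\<^esub> v else \<zero>\<^bsub>B\<^esub>)) \<and>
      (\<forall>xs. (\<forall>(i, n)\<in>set xs. i < k \<and> n \<le> 0) \<longrightarrow>
         (\<forall>e. \<forall>v\<in>carrier B.
            Y (jet_monomial k Ps xs) e v =
              series_prod_list B
                (map (\<lambda>(i, n). series_scale B (1 / fact (nat (- n)))
                   ((series_deriv B ^^ nat (- n)) (Y (jet_monomial k Ps [(i, 0)])))) xs) e v))"
  shows "\<exists>Y. is_Yg Y \<and>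
      twisted_module A (one A) (jet_T k Ps) (jet_Y k Ps) (jet_aut k m \<alpha> Ps) B m Y \<and>
      (\<forall>Y'. is_Yg Y' \<longrightarrow> (\<forall>a\<in>carrier A. \<forall>e. \<forall>v\<in>carrier B. Y' a e v = Y a e v))"
proof -
  have m: "0 < m" using order by (simp add: has_order_def)
  have Ps': "set Ps \<subseteq> polys {..<k}" using Ps by simp
  interpret twisted_jet_module k m \<alpha> Ps
  proof unfold_locales
    fix P assume P: "P \<in> set Ps"
    then have "P \<in> I" using genideal_poly_self[OF Ps'] by (auto simp: I_def)
    moreover have "acts_to k g P (eval_poly const (\<lambda>i. const (unity_root m ^ \<alpha> i) * var i) P)"
      using P Ps' g(1) diagonal by (intro acts_to_diagonal) auto
    ultimately show "eval_poly const (\<lambda>i. const (unity_root m ^ \<alpha> i) * var i) P \<in> Idl\<^bsub>poly_ring {..<k}\<^esub> (set Ps)"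
      using preserves unfolding I_def by blast
  qed (use m Ps' in simp_all)
  have is_Yg_iff: "is_Yg Y \<longleftrightarrow> represents Y" for Y
  proof -
    have "is_Yg Y \<longleftrightarrow> series_map m V.Q M.Q Y \<and> generator_condition Y \<and> product_condition Y"
      unfolding is_Yg_def A_def B_def generator_condition_def product_condition_def ..
    then show ?thesis
      using represents_series_map represents_generator represents_product represents_unique by blast
  qed
  have "Y' a e v = twisted_Y a e v"
    if "represents Y'" "a \<in> carrier V.Q" "v \<in> carrier M.Q" for Y' a e v
    using that represents_twisted_Y by (auto simp: represents_cls elim!: V.carrierE)
  then show ?thesis
    unfolding is_Yg_iff unfolding A_def B_def
    using represents_twisted_Y twisted_module_represents[OF represents_twisted_Y] by blast
qed

end
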